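(* Let $n\ge 1$ and $l\ge 2$ be integers and let $H$ be a transitive abelian subgroup of $\mathrm{Sym}_n$. Then $S_{n,l}(H)$ has a group of fractions $G=S_{n,l}(H)\langle x_1^l\rangle^{-1}$. Furthermore: (i) $T(G)=\{ g\in G\mid o(g)<\infty\}=\{x_1^{-l+1}x_{j_1}\cdots x_{j_{l-1}}\mid j_1,\dots,j_{l-1}\in\{ 1,2,\dots ,n \}\}$ is a normal abelian subgroup of $G$, and $T(G)\cong H^{l-1}$, the direct product of $l-1$ copies of $H$. (ii) $G=T(G)\rtimes \mathrm{gr}\langle x_1\rangle$. (iii) $\mathrm{gr}\langle x_1^l\rangle$ is a central subgroup of finite index in $G$.
   Context: $\mathrm{Sym}_n$ is the symmetric group on $\{1,\dots,n\}$; a subgroup $H$ is transitive if it acts transitively on $\{1,\dots,n\}$. For a subgroup $H$ of $\mathrm{Sym}_n$ and an integer $l\ge 2$, $S_{n,l}(H)$ is the monoid given by the presentation $$S_{n,l}(H)=\langle x_1,\dots ,x_n\mid x_{i_1}x_{i_2}\cdots x_{i_l} =x_{\sigma (i_1)} x_{\sigma (i_2)} \cdots x_{\sigma (i_l)},\ \sigma \in H,\ i_1,\ldots ,i_l \in \{1,\ldots ,n\}\rangle.$$ When $H$ is transitive, the element $x_1^l$ is central in $S_{n,l}(H)$, and $S_{n,l}(H)\langle x_1^l\rangle^{-1}$ denotes the central localization of $S_{n,l}(H)$ at the submonoid $\langle x_1^l\rangle$ generated by $x_1^l$. A group of fractions of a monoid $S$ is a group containing $S$ as a submonoid in which every element can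 be written as $st^{-1}$ and as $u^{-1}v$ with $s,t,u,v\in S$. $o(g)$ denotes the order of $g$, and $\mathrm{gr}\langle g\rangle$ denotes the subgroup generated by $g$. *)

theory Defs
  imports "HOL-Algebra.Sym_Groups" "HOL-Algebra.Product_Groups" "HOL-Algebra.Multiplicative_Group"
begin

section \<open>Monoid presentations\<close>

text \<open>The free monoid on \<open>X\<close> is \<open>lists X\<close> under concatenation;
  \<open>pres_cong X R\<close> is the least monoid congruence on it containing
  the relations \<open>u = v\<close> with \<open>(u, v) \<in> R\<close>.\<close>

inductive_set pres_cong :: "'a set \<Rightarrow> ('a list \<times> 'a list) set \<Rightarrow> ('a list \<times> 'a list) set"
  for X :: "'a set" and R :: "('a list \<times> 'a list) set" where
  rel: "(u, v) \<in> R \<Longrightarrow> u \<in> lists X \<Longrightarrow> v \<in> lists X \<Longrightarrow> (u, v) \<in> pres_cong X R"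
| refl: "u \<in> lists X \<Longrightarrow> (u, u) \<in> pres_cong X R"
| sym: "(u, v) \<in> pres_cong X R \<Longrightarrow> (v, u) \<in> pres_cong X R"
| trans: "(u, v) \<in> pres_cong X R \<Longrightarrow> (v, w) \<in> pres_cong X R \<Longrightarrow> (u, w) \<in> pres_cong X R"
| append: "(u, v) \<in> pres_cong X R \<Longrightarrow> (u', v') \<in> pres_cong X R \<Longrightarrow> (u @ u', v @ v') \<in> pres_cong X R"

definition presented_monoid :: "'a set \<Rightarrow> ('a list \<times> 'a list) set \<Rightarrow> 'a list set monoid" where
  "presented_monoid X R =
     \<lparr> carrier = lists X // pres_cong X R,
       mult = (\<lambda>A B. \<Union>u\<in>A. \<Union>v\<in>B. pres_cong X R `` {u @ v}),
       one = pres_cong X R `` {[]} \<rparr>"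

definition presented_gen :: "'a set \<Rightarrow> ('a list \<times> 'a list) set \<Rightarrow> 'a \<Rightarrow> 'a list set" where
  "presented_gen X R a = pres_cong X R `` {[a]}"

section \<open>The monoid $S_{n,l}(H)$\<close>

definition S_rels :: "nat \<Rightarrow> nat \<Rightarrow> (nat \<Rightarrow> nat) set \<Rightarrow> (nat list \<times> nat list) set" where
  "S_rels n l H = {(w, map \<sigma> w) | w \<sigma>. w \<in> lists {1..n} \<and> length w = l \<and> \<sigma> \<in> H}"

definition S_monoid :: "nat \<Rightarrow> nat \<Rightarrow> (nat \<Rightarrow> nat) set \<Rightarrow> nat list set monoid" where
  "S_monoid n l H = presented_monoid {1..n} (S_rels n l H)"

definition S_gen :: "nat \<Rightarrow> nat \<Rightarrow> (nat \<Rightarrow> nat) set \<Rightarrow> nat \<Rightarrow> nat list set" where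
  "S_gen n l H i = presented_gen {1..n} (S_rels n l H) i"

definition transitive_on :: "('a \<Rightarrow> 'a) set \<Rightarrow> 'a set \<Rightarrow> bool" where
  "transitive_on H E \<longleftrightarrow> (\<forall>i\<in>E. \<forall>j\<in>E. \<exists>\<sigma>\<in>H. \<sigma> i = j)"

section \<open>Central localization and groups of fractions\<close>

text \<open>\<open>loc_monoid S Z\<close> is the localization of the monoid \<open>S\<close> at a central submonoid \<open>Z\<close>;
  the class of \<open>(s, a)\<close> is the fraction \<open>s a\<^sup>-\<^sup>1\<close>. Since \<open>S\<close> need not be
  cancellative, equality of fractions is tested after multiplication by an element of \<open>Z\<close>.\<close>

definition loc_rel :: "('a, 'b) monoid_scheme \<Rightarrow> 'a set \<Rightarrow> (('a \<times> 'a) \<times> ('a \<times> 'a)) set" where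
  "loc_rel S Z = {((s, a), (t, b)). s \<in> carrier S \<and> t \<in> carrier S \<and> a \<in> Z \<and> b \<in> Z \<and>
     (\<exists>c\<in>Z. s \<otimes>\<^bsub>S\<^esub> b \<otimes>\<^bsub>S\<^esub> c = t \<otimes>\<^bsub>S\<^esub> a \<otimes>\<^bsub>S\<^esub> c)}"

definition loc_monoid :: "('a, 'b) monoid_scheme \<Rightarrow> 'a set \<Rightarrow> ('a \<times> 'a) set monoid" where
  "loc_monoid S Z =
     \<lparr> carrier = (carrier S \<times> Z) // loc_rel S Z,
       mult = (\<lambda>A B. \<Union>(s, a)\<in>A. \<Union>(t, b)\<in>B. loc_rel S Z `` {(s \<otimes>\<^bsub>S\<^esub> t, a \<otimes>\<^bsub>S\<^esub> b)}),
       one = loc_rel S Z `` {(\<one>\<^bsub>S\<^esub>, \<one>\<^bsub>S\<^esub>)} \<rparr>"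

definition loc_map :: "('a, 'b) monoid_scheme \<Rightarrow> 'a set \<Rightarrow> 'a \<Rightarrow> ('a \<times> 'a) set" where
  "loc_map S Z s = loc_rel S Z `` {(s, \<one>\<^bsub>S\<^esub>)}"

definition submonoid_gen :: "('a, 'b) monoid_scheme \<Rightarrow> 'a set \<Rightarrow> 'a set" where
  "submonoid_gen S A = (\<lambda>M. submonoid M S) hull A"

text \<open>\<open>S\<close> is regarded as a submonoid of \<open>G\<close> via the embedding \<open>\<iota>\<close>.\<close>

definition group_of_fractions ::
  "('a, 'b) monoid_scheme \<Rightarrow> ('c, 'd) monoid_scheme \<Rightarrow> ('a \<Rightarrow> 'c) \<Rightarrow> bool" where
  "group_of_fractions S G \<iota> \<longleftrightarrow>
     monoid S \<and> group G \<and>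
     \<iota> \<in> hom S G \<and> \<iota> \<one>\<^bsub>S\<^esub> = \<one>\<^bsub>G\<^esub> \<and> inj_on \<iota> (carrier S) \<and>
     (\<forall>g\<in>carrier G.
        (\<exists>s\<in>carrier S. \<exists>t\<in>carrier S. g = \<iota> s \<otimes>\<^bsub>G\<^esub> inv\<^bsub>G\<^esub> \<iota> t) \<and>
        (\<exists>u\<in>carrier S. \<exists>v\<in>carrier S. g = inv\<^bsub>G\<^esub> \<iota> u \<otimes>\<^bsub>G\<^esub> \<iota> v))"

section \<open>Group-theoretic notions\<close>

text \<open>In HOL-Algebra an element of infinite order has \<open>ord\<close> equal to \<open>0\<close>.\<close>

definition torsion_elements :: "('a, 'b) monoid_scheme \<Rightarrow> 'a set" where
  "torsion_elements G = {g \<in> carrier G. group.ord G g \<noteq> 0}"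

definition internal_semidirect :: "('a, 'b) monoid_scheme \<Rightarrow> 'a set \<Rightarrow> 'a set \<Rightarrow> bool" where
  "internal_semidirect G N K \<longleftrightarrow>
     N \<lhd> G \<and> subgroup K G \<and> N \<inter> K = {\<one>\<^bsub>G\<^esub>} \<and> N <#>\<^bsub>G\<^esub> K = carrier G"

definition central_subgroup :: "'a set \<Rightarrow> ('a, 'b) monoid_scheme \<Rightarrow> bool" where
  "central_subgroup Z G \<longleftrightarrow>
     subgroup Z G \<and> (\<forall>z\<in>Z. \<forall>g\<in>carrier G. z \<otimes>\<^bsub>G\<^esub> g = g \<otimes>\<^bsub>G\<^esub> z)"

end

theory Submission
  imports Defs
begin

text \<open>
  A transitive abelian permutation group \<open>H\<close> is regular, so the letter \<open>x\<^sub>i\<close> may be renamed to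
  the unique \<open>\<sigma> \<in> H\<close> with \<open>\<sigma> 1 = i\<close>. The defining relations then say that any \<open>l\<close> consecutive
  letters of a word may be multiplied simultaneously by one element of \<open>H\<close>.

  Such a move does not change, up to a common factor from \<open>H\<close>, the \<open>l\<close> products of the letters
  standing at positions in a fixed residue class modulo \<open>l\<close>. Together with the length, the
  \<open>l\<close>-tuple of these products modulo the diagonal is therefore an invariant. Concatenation
  shifts the tuple of the right factor cyclically by the length of the left factor, so the
  invariant takes values in the group \<open>\<Gamma> = (H\<^sup>l / diagonal) \<rtimes> \<int>\<close>, where a generator of \<open>\<int>\<close> acts
  as the cyclic shift, an automorphism of order dividing \<open>l\<close>. Dividing by the entry at residue
  \<open>-1\<close> picks one tuple in each coset of the diagonal (\<open>tuples\<close>, \<open>group_twist_group\<close>).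

  The invariant separates the elements of the monoid: multiplying windows of length \<open>l\<close> from left
  to right turns all letters but the last \<open>l - 1\<close> into \<open>x\<^sub>1\<close> (\<open>cong_normal_form\<close>), and a word with
  fewer than \<open>l\<close> letters can be read off its tuple (\<open>word_short_inj\<close>). Hence the monoid embeds
  into \<open>\<Gamma>\<close>. Its image contains every element of degree at least \<open>l - 1\<close> (\<open>ex_word_of_degree\<close>),
  and \<open>x\<^sub>1\<^sup>l\<close> is central of degree \<open>l\<close> in \<open>\<Gamma>\<close>, so inverting \<open>x\<^sub>1\<^sup>l\<close> produces exactly \<open>\<Gamma>\<close>
  (\<open>central_localization_embedding\<close>, \<open>localization_iso\<close>).

  The remaining claims are visible in \<open>\<Gamma>\<close>. The degree is a homomorphism onto \<open>\<int>\<close> with finite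
  kernel \<open>H\<^sup>l / diagonal\<close>, isomorphic to \<open>H\<^bsup>l-1\<^esup>\<close>; a homomorphism onto \<open>\<int>\<close> with finite kernel has
  the torsion elements as its kernel and is split by any element of degree one. Finally,
  every element of degree \<open>l - 1\<close> is the invariant of a word of that length, which gives the
  listed form of the torsion elements.
\<close>

section \<open>Homomorphisms to the integers with finite kernel\<close>

text \<open>The integers are torsion-free, so torsion lies in the kernel; conversely, the powers of an
  element of a finite kernel form a finite group.\<close>

lemma (in group) torsion_elements_eq_kernel:
  assumes deg: "\<delta> \<in> hom G integer_group" and fin: "finite (kernel G integer_group \<delta>)"
  shows "torsion_elements G = kernel G integer_group \<delta>"
proof -
  interpret deg: group_hom G integer_group \<delta>
    using deg by (simp add: group_hom_def group_hom_axioms_def is_group)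
  show ?thesis
  proof (intro equalityI subsetI)
    fix g assume "g \<in> torsion_elements G"
    then have g: "g \<in> carrier G" and ord: "ord g \<noteq> 0"
      by (auto simp: torsion_elements_def)
    have "int (ord g) * \<delta> g = \<delta> (g [^] ord g)"
      using deg.hom_nat_pow[OF g, of "ord g"] by (simp del: pow_ord_eq_1)
    then show "g \<in> kernel G integer_group \<delta>"
      using g ord by (simp add: kernel_def pow_ord_eq_1)
  next
    fix g assume "g \<in> kernel G integer_group \<delta>"
    then have g: "g \<in> carrier G" and "generate G {g} \<subseteq> kernel G integer_group \<delta>"
      using generate_subgroup_incl[OF _ deg.subgroup_kernel, of "{g}"] by (auto simp: kernel_def)
    then have "finite (generate G {g})" "generate G {g} \<noteq> {}"
      using fin finite_subset generate.one by blast+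
    then have "ord g \<noteq> 0"
      using g by (simp add: generate_pow_card)
    then show "g \<in> torsion_elements G"
      using g by (simp add: torsion_elements_def)
  qed
qed

text \<open>The powers of \<open>t\<close> split \<open>\<delta>\<close>, since \<open>\<delta> (t\<^sup>k) = k\<close>.\<close>

lemma (in group) kernel_semidirect_degree_one:
  assumes deg: "\<delta> \<in> hom G integer_group" and t: "t \<in> carrier G" "\<delta> t = 1"
  shows "internal_semidirect G (kernel G integer_group \<delta>) (generate G {t})"
proof -
  interpret deg: group_hom G integer_group \<delta>
    using deg by (simp add: group_hom_def group_hom_axioms_def is_group)
  have gen: "generate G {t} = {t [^] k |k::int. True}"
    using t generate_pow by simp
  have deg_pow: "\<delta> (t [^] k) = k" for k :: int
    using t by (simp add: deg.hom_int_pow)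
  have "kernel G integer_group \<delta> \<inter> generate G {t} = {\<one>}"
    using deg_pow by (auto simp: gen kernel_def intro: exI[of _ "0::int"])
  moreover have "kernel G integer_group \<delta> <#> generate G {t} = carrier G"
  proof (intro equalityI subsetI)
    fix g assume g: "g \<in> carrier G"
    have "g \<otimes> inv (t [^] \<delta> g) \<in> kernel G integer_group \<delta>"
      using g t by (simp add: kernel_def deg_pow)
    moreover have "g = g \<otimes> inv (t [^] \<delta> g) \<otimes> t [^] \<delta> g"
      using g t by (simp add: m_assoc)
    ultimately show "g \<in> kernel G integer_group \<delta> <#> generate G {t}"
      unfolding set_mult_def gen by blast
  qed (use t in \<open>auto simp: set_mult_def gen kernel_def\<close>)
  ultimately show ?thesis
    using t deg.normal_kernel generate_is_subgroup by (simp add: internal_semidirect_def)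
qed

text \<open>Writing \<open>g = a t\<^bsup>\<delta> g\<^esup>\<close> with \<open>a\<close> in the kernel and reducing the exponent modulo \<open>l\<close> leaves
  finitely many coset representatives.\<close>

lemma (in group) finite_index_power_of_degree_one:
  assumes deg: "\<delta> \<in> hom G integer_group" and fin: "finite (kernel G integer_group \<delta>)"
    and t: "t \<in> carrier G" "\<delta> t = 1" and l: "l > 0"
    and central: "\<And>g. g \<in> carrier G \<Longrightarrow> t [^] (l::nat) \<otimes> g = g \<otimes> t [^] l"
  shows "central_subgroup (generate G {t [^] l}) G"
    and "finite (rcosets (generate G {t [^] l}))"
proof -
  interpret deg: group_hom G integer_group \<delta>
    using deg by (simp add: group_hom_def group_hom_axioms_def is_group)
  let ?Z = "generate G {t [^] l}" and ?K = "kernel G integer_group \<delta>"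
  have gen: "?Z = {(t [^] l) [^] k |k::int. True}"
    using t generate_pow by simp
  have Z: "subgroup ?Z G"
    using t by (simp add: generate_is_subgroup)
  have Z_central: "z \<otimes> g = g \<otimes> z" if "z \<in> ?Z" and g: "g \<in> carrier G" for z g
    using that(1)
  proof induction
    case (inv h)
    then show ?case
      using t g central[OF g] by (metis inv_solve_left inv_solve_right m_assoc nat_pow_closed singletonD inv_closed m_closed)
  next
    case (eng h1 h2)
    have "h1 \<in> carrier G" "h2 \<in> carrier G"
      using eng.hyps subgroup.subset[OF Z] by blast+
    then show ?case
      using eng.IH g by (metis m_assoc)
  qed (use g central in auto)
  show "central_subgroup ?Z G"
    unfolding central_subgroup_def using Z Z_central by blast
  have "rcosets ?Z \<subseteq> (\<lambda>(a, k). ?Z #> (a \<otimes> t [^] k)) ` (?K \<times> {0..<int l})"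
  proof
    fix C assume "C \<in> rcosets ?Z"
    then obtain g where g: "g \<in> carrier G" and C: "C = ?Z #> g"
      by (auto simp: RCOSETS_def)
    define k q where "k = \<delta> g mod int l" and "q = \<delta> g div int l"
    have kq: "\<delta> g = int l * q + k"
      by (simp add: k_def q_def)
    define a where "a = g \<otimes> inv (t [^] \<delta> g)"
    have a: "a \<in> ?K"
      using g t by (simp add: a_def kernel_def deg.hom_int_pow)
    have z: "(t [^] l) [^] q \<in> ?Z"
      by (auto simp: gen)
    have "g = a \<otimes> t [^] \<delta> g"
      using g t by (simp add: a_def m_assoc)
    also have "t [^] \<delta> g = (t [^] l) [^] q \<otimes> t [^] k"
      unfolding kq using t by (simp add: int_pow_mult int_pow_pow flip: int_pow_int)
    also have "a \<otimes> ((t [^] l) [^] q \<otimes> t [^] k) = (t [^] l) [^] q \<otimes> (a \<otimes> t [^] k)"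
      using Z_central[OF z, of a] t a by (simp add: kernel_def flip: m_assoc)
    finally have "g \<in> ?Z #> (a \<otimes> t [^] k)"
      using z by (auto simp: r_coset_def)
    then have "C = ?Z #> (a \<otimes> t [^] k)"
      unfolding C using repr_independence[OF _ _ Z] a t by (metis (no_types, lifting) int_pow_closed kernel_def m_closed mem_Collect_eq)
    moreover have "k \<in> {0..<int l}"
      using l by (simp add: k_def)
    ultimately show "C \<in> (\<lambda>(a, k). ?Z #> (a \<otimes> t [^] k)) ` (?K \<times> {0..<int l})"
      using a by auto
  qed
  then show "finite (rcosets ?Z)"
    using fin by (meson finite_SigmaI finite_atLeastLessThan_int finite_imageI finite_subset)
qed

section \<open>Quotients of monoids by kernels and central localizations\<close>

text \<open>A congruence that is the kernel of a multiplicative map \<open>p\<close> into a monoid yields a quotient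
  embedded in that monoid. Both the presented monoid and its localization are of this form; the
  monoid laws of the quotient come from the target.\<close>

lemma monoid_quotient_by_kernel:
  fixes p :: "'x \<Rightarrow> 'g" and M (structure)
  assumes M: "monoid M"
    and kernel: "\<And>x y. (x, y) \<in> r \<longleftrightarrow> x \<in> X \<and> y \<in> X \<and> p x = p y"
    and p: "\<And>x. x \<in> X \<Longrightarrow> p x \<in> carrier M"
    and op: "\<And>x y. x \<in> X \<Longrightarrow> y \<in> X \<Longrightarrow> op x y \<in> X"
      "\<And>x y. x \<in> X \<Longrightarrow> y \<in> X \<Longrightarrow> p (op x y) = p x \<otimes> p y"
    and e: "e \<in> X" "p e = \<one>"
    and Q: "Q = \<lparr>carrier = X // r, mult = (\<lambda>A B. \<Union>x\<in>A. \<Union>y\<in>B. r `` {op x y}), one = r `` {e}\<rparr>"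
  obtains \<phi> where "monoid Q" "\<phi> \<in> hom Q M" "\<phi> \<one>\<^bsub>Q\<^esub> = \<one>" "inj_on \<phi> (carrier Q)"
    "\<phi> ` carrier Q = p ` X" "\<And>x. x \<in> X \<Longrightarrow> \<phi> (r `` {x}) = p x"
    "\<And>x y. x \<in> X \<Longrightarrow> y \<in> X \<Longrightarrow> r `` {x} \<otimes>\<^bsub>Q\<^esub> r `` {y} = r `` {op x y}"
proof -
  interpret M: monoid M by (rule M)
  define \<phi> where "\<phi> A = the_elem (p ` A)" for A
  have class_eq: "r `` {x} = {y \<in> X. p y = p x}" if "x \<in> X" for x
    using that by (auto simp: kernel)
  have \<phi>: "\<phi> (r `` {x}) = p x" if "x \<in> X" for x
  proof -
    have "p ` (r `` {x}) = {p x}"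
      using that by (auto simp: class_eq)
    then show ?thesis by (simp add: \<phi>_def)
  qed
  have mult: "r `` {x} \<otimes>\<^bsub>Q\<^esub> r `` {y} = r `` {op x y}" if "x \<in> X" "y \<in> X" for x y
  proof -
    have eq: "r `` {op x' y'} = r `` {op x y}" if "x' \<in> r `` {x}" "y' \<in> r `` {y}" for x' y'
    proof -
      have "x' \<in> X" "y' \<in> X" "p x' = p x" "p y' = p y"
        using that \<open>x \<in> X\<close> \<open>y \<in> X\<close> by (auto simp: kernel)
      then show ?thesis
        using \<open>x \<in> X\<close> \<open>y \<in> X\<close> by (simp add: class_eq op)
    qed
    have nonempty: "r `` {x} \<noteq> {}" "r `` {y} \<noteq> {}"
      using that by (auto simp: class_eq)
    have "(\<Union>x'\<in>r `` {x}. \<Union>y'\<in>r `` {y}. r `` {op x' y'})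
        = (\<Union>x'\<in>r `` {x}. \<Union>y'\<in>r `` {y}. r `` {op x y})"
      by (intro SUP_cong HOL.refl eq)
    also have "\<dots> = r `` {op x y}"
      unfolding UN_constant using nonempty by (simp only: if_False)
    finally show ?thesis
      by (simp only: Q monoid.simps)
  qed
  have carrier: "A \<in> carrier Q \<longleftrightarrow> (\<exists>x\<in>X. A = r `` {x})" for A
    by (auto simp: Q quotient_def)
  have one: "\<one>\<^bsub>Q\<^esub> = r `` {e}"
    by (simp add: Q)
  have class_cong: "r `` {x} = r `` {y}" if "x \<in> X" "y \<in> X" "p x = p y" for x y
    using that by (simp add: class_eq)
  have inj: "inj_on \<phi> (carrier Q)"
  proof (rule inj_onI)
    fix A B assume "A \<in> carrier Q" "B \<in> carrier Q" and eq: "\<phi> A = \<phi> B"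
    then obtain x y where xy: "x \<in> X" "A = r `` {x}" "y \<in> X" "B = r `` {y}"
      unfolding carrier by blast
    then have "p x = p y"
      using eq \<phi> by simp
    then show "A = B"
      unfolding xy(2,4) by (rule class_cong[OF xy(1,3)])
  qed
  have "monoid Q"
  proof (rule monoidI)
    fix A B assume "A \<in> carrier Q" "B \<in> carrier Q"
    then show "A \<otimes>\<^bsub>Q\<^esub> B \<in> carrier Q"
      unfolding carrier by (metis mult op(1))
  next
    show "\<one>\<^bsub>Q\<^esub> \<in> carrier Q"
      using e by (auto simp: carrier one)
  next
    fix A B C assume "A \<in> carrier Q" "B \<in> carrier Q" "C \<in> carrier Q"
    then obtain x y z where xyz: "x \<in> X" "A = r `` {x}" "y \<in> X" "B = r `` {y}" "z \<in> X" "C = r `` {z}"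
      unfolding carrier by blast
    have "r `` {op (op x y) z} = r `` {op x (op y z)}"
      by (rule class_cong) (simp_all add: xyz op p M.m_assoc)
    then show "A \<otimes>\<^bsub>Q\<^esub> B \<otimes>\<^bsub>Q\<^esub> C = A \<otimes>\<^bsub>Q\<^esub> (B \<otimes>\<^bsub>Q\<^esub> C)"
      by (simp only: xyz mult op(1))
  next
    fix A assume "A \<in> carrier Q"
    then obtain x where x: "x \<in> X" "A = r `` {x}"
      unfolding carrier by blast
    have "r `` {op e x} = r `` {x}" "r `` {op x e} = r `` {x}"
      by (rule class_cong; simp add: x e op p)+
    then show "\<one>\<^bsub>Q\<^esub> \<otimes>\<^bsub>Q\<^esub> A = A" "A \<otimes>\<^bsub>Q\<^esub> \<one>\<^bsub>Q\<^esub> = A"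
      by (simp_all only: one x mult e)
  qed
  moreover have "\<phi> \<in> hom Q M"
  proof (rule homI)
    fix A B assume "A \<in> carrier Q" "B \<in> carrier Q"
    then obtain x y where xy: "x \<in> X" "A = r `` {x}" "y \<in> X" "B = r `` {y}"
      unfolding carrier by blast
    show "\<phi> A \<in> carrier M" using xy by (simp add: \<phi> p)
    show "\<phi> (A \<otimes>\<^bsub>Q\<^esub> B) = \<phi> A \<otimes> \<phi> B" using xy by (simp add: mult \<phi> op)
  qed
  moreover have "\<phi> \<one>\<^bsub>Q\<^esub> = \<one>"
    using e by (simp add: one \<phi>)
  moreover have "\<phi> ` carrier Q = p ` X"
  proof -
    have "carrier Q = (\<lambda>x. r `` {x}) ` X"
      using carrier by blast
    then show ?thesis
      by (simp add: image_image \<phi>)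
  qed
  ultimately show thesis
    using inj \<phi> mult by (intro that)
qed

text \<open>If \<open>S\<close> embeds into a group \<open>\<Gamma>\<close> such that \<open>Z\<close> becomes central and every element of \<open>\<Gamma>\<close> is a
  fraction with denominator in \<open>Z\<close>, then sending \<open>s a\<^sup>-\<^sup>1\<close> to \<open>f s (f a)\<^sup>-\<^sup>1\<close> identifies the
  localization with \<open>\<Gamma>\<close>: equality of fractions is exactly equality of these values, as \<open>\<Gamma>\<close> is
  cancellative.\<close>

lemma central_localization_embedding:
  fixes S (structure) and \<Gamma> :: "('g, 'm) monoid_scheme"
  assumes S: "monoid S" and \<Gamma>: "group \<Gamma>" and Z: "submonoid Z S"
    and f: "f \<in> hom S \<Gamma>" "f \<one> = \<one>\<^bsub>\<Gamma>\<^esub>" "inj_on f (carrier S)"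
    and central: "\<And>z \<gamma>. z \<in> Z \<Longrightarrow> \<gamma> \<in> carrier \<Gamma> \<Longrightarrow> f z \<otimes>\<^bsub>\<Gamma>\<^esub> \<gamma> = \<gamma> \<otimes>\<^bsub>\<Gamma>\<^esub> f z"
    and fractions: "\<And>\<gamma>. \<gamma> \<in> carrier \<Gamma> \<Longrightarrow> \<exists>s\<in>carrier S. \<exists>z\<in>Z. \<gamma> \<otimes>\<^bsub>\<Gamma>\<^esub> f z = f s"
  obtains \<theta> where "\<theta> \<in> iso (loc_monoid S Z) \<Gamma>"
    "\<And>s. s \<in> carrier S \<Longrightarrow> loc_map S Z s \<in> carrier (loc_monoid S Z)"
    "\<And>s. s \<in> carrier S \<Longrightarrow> \<theta> (loc_map S Z s) = f s"
    "group_of_fractions S (loc_monoid S Z) (loc_map S Z)"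
proof -
  interpret S: monoid S by (rule S)
  interpret \<Gamma>: group \<Gamma> by (rule \<Gamma>)
  interpret Z: submonoid Z S by (rule Z)
  let ?G = "loc_monoid S Z" and ?i = "loc_map S Z" and ?r = "loc_rel S Z"
  define p where "p = (\<lambda>(s, a). f s \<otimes>\<^bsub>\<Gamma>\<^esub> inv\<^bsub>\<Gamma>\<^esub> f a)"
  define op where "op = (\<lambda>(s, a) (t, b). (s \<otimes> t, a \<otimes> b))"
  have fc [simp]: "s \<in> carrier S \<Longrightarrow> f s \<in> carrier \<Gamma>" for s
    using f(1) by (rule hom_in_carrier)
  have fm [simp]: "s \<in> carrier S \<Longrightarrow> t \<in> carrier S \<Longrightarrow> f (s \<otimes> t) = f s \<otimes>\<^bsub>\<Gamma>\<^esub> f t" for s t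
    using f(1) by (rule hom_mult)
  have ZS [simp]: "z \<in> Z \<Longrightarrow> z \<in> carrier S" for z
    using Z.subset by blast
  have central_inv: "inv\<^bsub>\<Gamma>\<^esub> f z \<otimes>\<^bsub>\<Gamma>\<^esub> \<gamma> = \<gamma> \<otimes>\<^bsub>\<Gamma>\<^esub> inv\<^bsub>\<Gamma>\<^esub> f z" if "z \<in> Z" "\<gamma> \<in> carrier \<Gamma>" for z \<gamma>
    using that central[of z "inv\<^bsub>\<Gamma>\<^esub> \<gamma>"]
    by (metis ZS \<Gamma>.inv_closed \<Gamma>.inv_inv \<Gamma>.inv_mult_group fc)
  have kernel: "(x, y) \<in> ?r \<longleftrightarrow> x \<in> carrier S \<times> Z \<and> y \<in> carrier S \<times> Z \<and> p x = p y" for x y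
  proof -
    obtain s a t b where xy: "x = (s, a)" "y = (t, b)"
      by (cases x; cases y)
    have "(\<exists>c\<in>Z. s \<otimes> b \<otimes> c = t \<otimes> a \<otimes> c) \<longleftrightarrow> p x = p y"
      if mem: "s \<in> carrier S" "t \<in> carrier S" "a \<in> Z" "b \<in> Z"
    proof -
      have "s \<otimes> b \<otimes> c = t \<otimes> a \<otimes> c \<longleftrightarrow> f s \<otimes>\<^bsub>\<Gamma>\<^esub> f b = f t \<otimes>\<^bsub>\<Gamma>\<^esub> f a" if "c \<in> Z" for c
        using inj_on_eq_iff[OF f(3), of "s \<otimes> b \<otimes> c" "t \<otimes> a \<otimes> c"] mem that by simp
      then have "(\<exists>c\<in>Z. s \<otimes> b \<otimes> c = t \<otimes> a \<otimes> c) \<longleftrightarrow> f s \<otimes>\<^bsub>\<Gamma>\<^esub> f b = f t \<otimes>\<^bsub>\<Gamma>\<^esub> f a"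
        using Z.one_closed by blast
      also have "\<dots> \<longleftrightarrow> f s \<otimes>\<^bsub>\<Gamma>\<^esub> inv\<^bsub>\<Gamma>\<^esub> f a = f t \<otimes>\<^bsub>\<Gamma>\<^esub> inv\<^bsub>\<Gamma>\<^esub> f b"
      proof -
        have "f s \<otimes>\<^bsub>\<Gamma>\<^esub> f b \<otimes>\<^bsub>\<Gamma>\<^esub> inv\<^bsub>\<Gamma>\<^esub> f a = f s \<otimes>\<^bsub>\<Gamma>\<^esub> inv\<^bsub>\<Gamma>\<^esub> f a \<otimes>\<^bsub>\<Gamma>\<^esub> f b"
          using mem central[of b "inv\<^bsub>\<Gamma>\<^esub> f a"] by (simp add: \<Gamma>.m_assoc)
        then have "f s \<otimes>\<^bsub>\<Gamma>\<^esub> f b \<otimes>\<^bsub>\<Gamma>\<^esub> inv\<^bsub>\<Gamma>\<^esub> f a = f t \<longleftrightarrow> f t = f s \<otimes>\<^bsub>\<Gamma>\<^esub> inv\<^bsub>\<Gamma>\<^esub> f a \<otimes>\<^bsub>\<Gamma>\<^esub> f b"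
          by (simp only: eq_commute)
        moreover have "f s \<otimes>\<^bsub>\<Gamma>\<^esub> f b \<otimes>\<^bsub>\<Gamma>\<^esub> inv\<^bsub>\<Gamma>\<^esub> f a = f t \<longleftrightarrow> f s \<otimes>\<^bsub>\<Gamma>\<^esub> f b = f t \<otimes>\<^bsub>\<Gamma>\<^esub> f a"
          by (rule \<Gamma>.inv_solve_right') (use mem in simp_all)
        moreover have "f s \<otimes>\<^bsub>\<Gamma>\<^esub> inv\<^bsub>\<Gamma>\<^esub> f a = f t \<otimes>\<^bsub>\<Gamma>\<^esub> inv\<^bsub>\<Gamma>\<^esub> f b \<longleftrightarrow> f t = f s \<otimes>\<^bsub>\<Gamma>\<^esub> inv\<^bsub>\<Gamma>\<^esub> f a \<otimes>\<^bsub>\<Gamma>\<^esub> f b"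
          by (rule \<Gamma>.inv_solve_right) (use mem in simp_all)
        ultimately show ?thesis by iprover
      qed
      finally show ?thesis by (simp add: xy p_def)
    qed
    then show ?thesis
      by (auto simp: xy loc_rel_def)
  qed
  have Geq: "?G = \<lparr>carrier = (carrier S \<times> Z) // ?r,
      mult = (\<lambda>A B. \<Union>x\<in>A. \<Union>y\<in>B. ?r `` {op x y}), one = ?r `` {(\<one>, \<one>)}\<rparr>"
    by (simp add: loc_monoid_def op_def case_prod_beta)
  have pc: "p x \<in> carrier \<Gamma>" if "x \<in> carrier S \<times> Z" for x
    using that by (auto simp: p_def)
  have opc: "op x y \<in> carrier S \<times> Z" if "x \<in> carrier S \<times> Z" "y \<in> carrier S \<times> Z" for x y
    using that by (auto simp: op_def)
  have pop: "p (op x y) = p x \<otimes>\<^bsub>\<Gamma>\<^esub> p y" if members: "x \<in> carrier S \<times> Z" "y \<in> carrier S \<times> Z" for x y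
  proof -
    obtain s a t b where xy: "x = (s, a)" "y = (t, b)"
      and mem: "s \<in> carrier S" "t \<in> carrier S" "a \<in> Z" "b \<in> Z"
      using members by (cases x; cases y) auto
    have "p (op x y) = f s \<otimes>\<^bsub>\<Gamma>\<^esub> (f t \<otimes>\<^bsub>\<Gamma>\<^esub> inv\<^bsub>\<Gamma>\<^esub> f b \<otimes>\<^bsub>\<Gamma>\<^esub> inv\<^bsub>\<Gamma>\<^esub> f a)"
      using mem by (simp add: xy p_def op_def \<Gamma>.inv_mult_group \<Gamma>.m_assoc)
    also have "\<dots> = p x \<otimes>\<^bsub>\<Gamma>\<^esub> p y"
      using mem central_inv[of a "f t \<otimes>\<^bsub>\<Gamma>\<^esub> inv\<^bsub>\<Gamma>\<^esub> f b"] by (simp add: xy p_def \<Gamma>.m_assoc)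
    finally show ?thesis .
  qed
  obtain \<theta> where G: "monoid ?G" and \<theta>: "\<theta> \<in> hom ?G \<Gamma>" "\<theta> \<one>\<^bsub>?G\<^esub> = \<one>\<^bsub>\<Gamma>\<^esub>" "inj_on \<theta> (carrier ?G)"
    "\<theta> ` carrier ?G = p ` (carrier S \<times> Z)"
    and \<theta>_class: "\<And>x. x \<in> carrier S \<times> Z \<Longrightarrow> \<theta> (?r `` {x}) = p x"
    and mult: "\<And>x y. x \<in> carrier S \<times> Z \<Longrightarrow> y \<in> carrier S \<times> Z \<Longrightarrow>
      ?r `` {x} \<otimes>\<^bsub>?G\<^esub> ?r `` {y} = ?r `` {op x y}"
    by (rule monoid_quotient_by_kernel[where p = p and r = ?r and e = "(\<one>, \<one>)" and op = op, OF \<Gamma>.is_monoid kernel pc opc pop _ _ Geq])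
      (use f(2) in \<open>simp_all add: p_def\<close>)
  have "p ` (carrier S \<times> Z) = carrier \<Gamma>"
  proof (intro equalityI subsetI)
    fix \<gamma> assume \<gamma>: "\<gamma> \<in> carrier \<Gamma>"
    then obtain s z where sz: "s \<in> carrier S" "z \<in> Z" "\<gamma> \<otimes>\<^bsub>\<Gamma>\<^esub> f z = f s"
      using fractions by blast
    then have "\<gamma> = p (s, z)"
      using \<gamma> by (simp add: p_def \<Gamma>.inv_solve_right)
    then show "\<gamma> \<in> p ` (carrier S \<times> Z)"
      using sz by blast
  qed (use pc in auto)
  then have \<theta>_iso: "\<theta> \<in> iso ?G \<Gamma>"
    using \<theta> by (simp add: iso_iff)
  have G: "group ?G"
  proof (rule monoid.group_l_invI[OF G])
    fix g assume g: "g \<in> carrier ?G"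
    have "\<theta> ` carrier ?G = carrier \<Gamma>"
      using \<theta>_iso by (simp add: iso_iff)
    moreover have \<theta>g: "\<theta> g \<in> carrier \<Gamma>"
      using \<theta>(1) g by (rule hom_in_carrier)
    ultimately obtain h where h: "h \<in> carrier ?G" "\<theta> h = inv\<^bsub>\<Gamma>\<^esub> \<theta> g"
      using \<Gamma>.inv_closed by (metis imageE)
    have "\<theta> (h \<otimes>\<^bsub>?G\<^esub> g) = \<theta> \<one>\<^bsub>?G\<^esub>"
      using g h \<theta>g by (simp add: hom_mult[OF \<theta>(1)] \<theta>(2))
    then have "h \<otimes>\<^bsub>?G\<^esub> g = \<one>\<^bsub>?G\<^esub>"
      using \<theta>(3) g h monoid.m_closed[OF G] monoid.one_closed[OF G] by (auto dest: inj_onD)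
    then show "\<exists>h\<in>carrier ?G. h \<otimes>\<^bsub>?G\<^esub> g = \<one>\<^bsub>?G\<^esub>"
      using h by blast
  qed
  interpret G: group ?G by (rule G)
  have ic: "?i s \<in> carrier ?G" if "s \<in> carrier S" for s
    using that by (auto simp: loc_map_def Geq intro!: quotientI)
  have \<theta>i: "\<theta> (?i s) = f s" if "s \<in> carrier S" for s
    using that by (simp add: loc_map_def \<theta>_class p_def f(2))
  have gof: "group_of_fractions S ?G ?i"
    unfolding group_of_fractions_def
  proof (intro conjI ballI)
    show "?i \<in> hom S ?G"
      by (rule homI) (simp_all add: ic, simp add: loc_map_def mult op_def)
    show "?i \<one> = \<one>\<^bsub>?G\<^esub>"
      by (simp add: loc_map_def loc_monoid_def)
    show "inj_on ?i (carrier S)"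
      by (metis \<theta>i f(3) inj_on_def)
  next
    fix g assume g: "g \<in> carrier ?G"
    have \<theta>g: "\<theta> g \<in> carrier \<Gamma>"
      using \<theta>(1) g by (rule hom_in_carrier)
    obtain s z where sz: "s \<in> carrier S" "z \<in> Z" "\<theta> g \<otimes>\<^bsub>\<Gamma>\<^esub> f z = f s"
      using fractions \<theta>g by blast
    have is_iz: "?i s \<in> carrier ?G" "?i z \<in> carrier ?G"
      using sz ic by simp_all
    have \<theta>_eq: "\<theta> (g \<otimes>\<^bsub>?G\<^esub> ?i z) = \<theta> (?i s)" "\<theta> (?i z \<otimes>\<^bsub>?G\<^esub> g) = \<theta> (?i s)"
      using sz g central[OF sz(2) \<theta>g] by (simp_all add: hom_mult[OF \<theta>(1)] ic \<theta>i)
    have s_eq: "g \<otimes>\<^bsub>?G\<^esub> ?i z = ?i s"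
      by (rule inj_onD[OF \<theta>(3) \<theta>_eq(1)]) (use g is_iz in simp_all)
    have s_eq': "?i z \<otimes>\<^bsub>?G\<^esub> g = ?i s"
      by (rule inj_onD[OF \<theta>(3) \<theta>_eq(2)]) (use g is_iz in simp_all)
    have "g = ?i s \<otimes>\<^bsub>?G\<^esub> inv\<^bsub>?G\<^esub> ?i z"
      by (rule iffD2[OF G.inv_solve_right[OF g is_iz] s_eq[symmetric]])
    then show "\<exists>s\<in>carrier S. \<exists>t\<in>carrier S. g = ?i s \<otimes>\<^bsub>?G\<^esub> inv\<^bsub>?G\<^esub> ?i t"
      using sz(1) ZS[OF sz(2)] by blast
    have "g = inv\<^bsub>?G\<^esub> ?i z \<otimes>\<^bsub>?G\<^esub> ?i s"
      by (rule iffD2[OF G.inv_solve_left[OF g is_iz(2,1)] s_eq'[symmetric]])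
    then show "\<exists>u\<in>carrier S. \<exists>v\<in>carrier S. g = inv\<^bsub>?G\<^esub> ?i u \<otimes>\<^bsub>?G\<^esub> ?i v"
      using sz(1) ZS[OF sz(2)] by blast
  qed (rule S, rule G)
  show thesis
    using that \<theta>_iso ic \<theta>i gof by blast
qed

lemma (in monoid) submonoid_gen_singleton:
  assumes "a \<in> carrier G"
  shows "submonoid_gen G {a} = range (\<lambda>k::nat. a [^] k)" and "submonoid (submonoid_gen G {a}) G"
proof -
  have powers: "submonoid (range (\<lambda>k::nat. a [^] k)) G"
  proof (rule submonoid.intro)
    show "\<one> \<in> range (\<lambda>k::nat. a [^] k)"
      by (rule range_eqI[of _ _ 0]) simp
  qed (use assms in \<open>auto simp: nat_pow_mult\<close>)
  show eq: "submonoid_gen G {a} = range (\<lambda>k::nat. a [^] k)"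
    unfolding submonoid_gen_def
  proof (rule hull_unique)
    show "{a} \<subseteq> range (\<lambda>k::nat. a [^] k)"
      using assms by (auto intro!: image_eqI[of _ _ "1::nat"])
    show "range (\<lambda>k::nat. a [^] k) \<subseteq> M" if "{a} \<subseteq> M" "submonoid M G" for M
    proof
      fix b assume "b \<in> range (\<lambda>k::nat. a [^] k)"
      then obtain k :: nat where "b = a [^] k" by blast
      moreover have "a [^] k \<in> M" for k :: nat
        using that by (induction k) (auto simp: submonoid_def)
      ultimately show "b \<in> M" by simp
    qed
  qed (rule powers)
  show "submonoid (submonoid_gen G {a}) G"
    unfolding eq by (rule powers)
qed

lemma comm_product_group:
  assumes "\<And>i. i \<in> I \<Longrightarrow> comm_group (G i)"
  shows "comm_group (product_group I G)"
proof (rule group.group_comm_groupI)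
  show "group (product_group I G)"
    using assms by (simp add: comm_group.axioms(2))
qed (use assms in \<open>auto simp: PiE_iff fun_eq_iff comm_groupE(4)\<close>)

section \<open>The twisted product of cyclic tuples with the integers\<close>

locale cyclic_twist = comm_group A for A (structure) +
  fixes l :: nat
  assumes l_ge_2: "l \<ge> 2"
begin

text \<open>Elements of \<open>A\<^sup>l\<close> are encoded as \<open>l\<close>-periodic functions on the integers, which turns the cyclic
  shift into a translation of the argument. The condition at \<open>-1\<close> selects one
  representative of each coset of the diagonal.\<close>

definition tuples :: "(int \<Rightarrow> 'a) set" where
  "tuples = {c. (\<forall>r. c r \<in> carrier A) \<and> (\<forall>r. c (r mod int l) = c r) \<and> c (-1) = \<one>}"

text \<open>The second tuple is shifted by the degree of the first factor; since the shift moves the entry at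
  \<open>-1\<close>, the result is normalized again by dividing by the new entry there.\<close>

definition twist_mult :: "(int \<Rightarrow> 'a) \<times> int \<Rightarrow> (int \<Rightarrow> 'a) \<times> int \<Rightarrow> (int \<Rightarrow> 'a) \<times> int" where
  "twist_mult = (\<lambda>(c, k) (d, m). (\<lambda>r. c r \<otimes> (d (r - k) \<otimes> inv d (- 1 - k)), k + m))"

definition twist_group :: "((int \<Rightarrow> 'a) \<times> int) monoid" where
  "twist_group = \<lparr>carrier = tuples \<times> UNIV, mult = twist_mult, one = (\<lambda>r. \<one>, 0)\<rparr>"

lemma tuplesD:
  assumes "c \<in> tuples"
  shows "c r \<in> carrier A" and "c (r mod int l) = c r" and "c (-1) = \<one>"
proof -
  from assms have "(\<forall>r. c r \<in> carrier A) \<and> (\<forall>r. c (r mod int l) = c r) \<and> c (-1) = \<one>"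
    unfolding tuples_def by (rule CollectD)
  then show "c r \<in> carrier A" and "c (r mod int l) = c r" and "c (-1) = \<one>"
    by (iprover)+
qed

lemma tuples_closed [simp]: "c \<in> tuples \<Longrightarrow> c r \<in> carrier A"
  by (rule tuplesD)

lemma tuples_periodic:
  assumes "c \<in> tuples" "r mod int l = s mod int l"
  shows "c r = c s"
proof -
  have "c r = c (r mod int l)"
    by (rule tuplesD(2)[OF assms(1), symmetric])
  also have "\<dots> = c s"
    unfolding assms(2) by (rule tuplesD(2)[OF assms(1)])
  finally show ?thesis .
qed

lemma tuples_normalized: "c \<in> tuples \<Longrightarrow> c (-1) = \<one>"
  by (rule tuplesD)

lemma tuplesI:
  assumes "\<And>r. c r \<in> carrier A" "\<And>r. c (r mod int l) = c r" "c (-1) = \<one>"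
  shows "c \<in> tuples"
  unfolding tuples_def using assms by (intro CollectI conjI allI)

lemma shift_mod: "d \<in> tuples \<Longrightarrow> d (r mod int l - k) = d (r - k)"
  by (rule tuples_periodic) (simp_all only: mod_diff_left_eq)

lemma twist_tuple:
  assumes "c \<in> tuples" "d \<in> tuples"
  shows "(\<lambda>r. c r \<otimes> (d (r - k) \<otimes> inv d (- 1 - k))) \<in> tuples"
  using assms tuples_periodic[of c "r mod int l" r for r]
  by (intro tuplesI) (simp_all add: shift_mod tuples_normalized)

text \<open>The tuple of the inverse of \<open>(c, k)\<close> in the group defined above.\<close>

lemma inverse_tuple: "c \<in> tuples \<Longrightarrow> (\<lambda>r. inv c (r + k) \<otimes> c (k - 1)) \<in> tuples"
  using shift_mod[of c _ "- k"]
  by (intro tuplesI) simp_all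

text \<open>Before normalization this is the semidirect product of \<open>A\<^sup>l\<close> with \<open>\<int>\<close>. The proof of associativity
  has to check that normalizing the intermediate product only contributes a factor that
  cancels.\<close>

lemma group_twist_group: "group twist_group"
proof (rule groupI)
  fix x y assume "x \<in> carrier twist_group" "y \<in> carrier twist_group"
  then show "x \<otimes>\<^bsub>twist_group\<^esub> y \<in> carrier twist_group"
    by (auto simp: twist_group_def twist_mult_def twist_tuple)
next
  show "\<one>\<^bsub>twist_group\<^esub> \<in> carrier twist_group"
    by (simp add: twist_group_def tuplesI)
next
  fix x y z
  assume "x \<in> carrier twist_group" "y \<in> carrier twist_group" "z \<in> carrier twist_group"
  then obtain c k d m e j where x: "x = (c, k)" "y = (d, m)" "z = (e, j)"
    and [simp]: "c \<in> tuples" "d \<in> tuples" "e \<in> tuples"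
    by (auto simp: twist_group_def)
  have cancel: "c0 \<otimes> ((d0 \<otimes> (e0 \<otimes> inv e1)) \<otimes> inv (d1 \<otimes> (e2 \<otimes> inv e1)))
      = c0 \<otimes> (d0 \<otimes> inv d1) \<otimes> (e0 \<otimes> inv e2)"
    if "c0 \<in> carrier A" "d0 \<in> carrier A" "d1 \<in> carrier A" "e0 \<in> carrier A" "e1 \<in> carrier A" "e2 \<in> carrier A"
    for c0 d0 d1 e0 e1 e2
  proof -
    have "c0 \<otimes> ((d0 \<otimes> (e0 \<otimes> inv e1)) \<otimes> inv (d1 \<otimes> (e2 \<otimes> inv e1)))
        = c0 \<otimes> (d0 \<otimes> inv d1) \<otimes> (e0 \<otimes> inv e2) \<otimes> (e1 \<otimes> inv e1)"
      using that by (simp only: inv_mult inv_inv inv_closed m_closed m_ac)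
    then show ?thesis
      using that by simp
  qed
  show "x \<otimes>\<^bsub>twist_group\<^esub> y \<otimes>\<^bsub>twist_group\<^esub> z = x \<otimes>\<^bsub>twist_group\<^esub> (y \<otimes>\<^bsub>twist_group\<^esub> z)"
    by (simp add: x twist_group_def twist_mult_def cancel diff_diff_eq)
next
  fix x assume "x \<in> carrier twist_group"
  then show "\<one>\<^bsub>twist_group\<^esub> \<otimes>\<^bsub>twist_group\<^esub> x = x"
    by (auto simp: twist_group_def twist_mult_def tuples_normalized)
next
  fix x assume "x \<in> carrier twist_group"
  then obtain c k where x: "x = (c, k)" and c [simp]: "c \<in> tuples"
    by (auto simp: twist_group_def)
  show "\<exists>y\<in>carrier twist_group. y \<otimes>\<^bsub>twist_group\<^esub> x = \<one>\<^bsub>twist_group\<^esub>"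
  proof (rule bexI)
    show "((\<lambda>r. inv c (r + k) \<otimes> c (k - 1)), - k) \<otimes>\<^bsub>twist_group\<^esub> x = \<one>\<^bsub>twist_group\<^esub>"
    proof -
      have "inv a \<otimes> b \<otimes> (a \<otimes> inv b) = \<one>" if "a \<in> carrier A" "b \<in> carrier A" for a b
      proof -
        have "inv a \<otimes> b \<otimes> (a \<otimes> inv b) = (a \<otimes> inv a) \<otimes> (b \<otimes> inv b)"
          using that by (simp only: inv_closed m_closed m_ac)
        then show ?thesis using that by simp
      qed
      then show ?thesis
        by (simp add: x twist_group_def twist_mult_def)
    qed
  qed (simp add: twist_group_def inverse_tuple)
qed

definition letter :: "'a \<Rightarrow> (int \<Rightarrow> 'a) \<times> int" where
  "letter h = (\<lambda>r. if r mod int l = 0 then h else \<one>, 1)"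

definition word :: "'a list \<Rightarrow> (int \<Rightarrow> 'a) \<times> int" where
  "word w = foldr (\<otimes>\<^bsub>twist_group\<^esub>) (map letter w) \<one>\<^bsub>twist_group\<^esub>"

sublocale \<Gamma>: group twist_group
  by (rule group_twist_group)

lemma mem_twist_group: "(c, k) \<in> carrier twist_group \<longleftrightarrow> c \<in> tuples"
  by (simp add: twist_group_def)

lemma snd_mult: "snd (x \<otimes>\<^bsub>twist_group\<^esub> y) = snd x + snd y"
  by (simp add: twist_group_def twist_mult_def case_prod_beta)

lemma twist_group_mult:
  "(c, k) \<otimes>\<^bsub>twist_group\<^esub> (d, m) = (\<lambda>r. c r \<otimes> (d (r - k) \<otimes> inv d (- 1 - k)), k + m)"
  by (simp add: twist_group_def twist_mult_def)

lemma twist_group_one: "\<one>\<^bsub>twist_group\<^esub> = (\<lambda>r. \<one>, 0)"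
  by (simp add: twist_group_def)

lemma neg_one_mod: "(- 1) mod int l = int l - 1"
  using l_ge_2 by (simp add: zmod_minus1)

lemma pred_mod:
  "(r - 1) mod int l = (if r mod int l = 0 then int l - 1 else r mod int l - 1)"
proof -
  have "(r - 1) mod int l = (r mod int l - 1) mod int l"
    by (simp add: mod_diff_left_eq)
  moreover have "0 \<le> r mod int l" "r mod int l < int l"
    using l_ge_2 by simp_all
  ultimately show ?thesis
    using neg_one_mod by auto
qed

lemma letter_closed [simp]: "h \<in> carrier A \<Longrightarrow> letter h \<in> carrier twist_group"
  unfolding letter_def mem_twist_group
  using l_ge_2 neg_one_mod by (intro tuplesI) auto

lemma word_Nil [simp]: "word [] = \<one>\<^bsub>twist_group\<^esub>"
  by (simp add: word_def)

lemma word_Cons [simp]: "word (h # w) = letter h \<otimes>\<^bsub>twist_group\<^esub> word w"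
  by (simp add: word_def)

lemma word_closed [simp]: "w \<in> lists (carrier A) \<Longrightarrow> word w \<in> carrier twist_group"
  by (induction w) auto

lemma word_append:
  "u \<in> lists (carrier A) \<Longrightarrow> v \<in> lists (carrier A) \<Longrightarrow>
    word (u @ v) = word u \<otimes>\<^bsub>twist_group\<^esub> word v"
  by (induction u) (auto simp: \<Gamma>.m_assoc)

lemma snd_word: "snd (word w) = int (length w)"
  by (induction w) (simp_all add: twist_group_one snd_mult letter_def)

text \<open>As long as a word has fewer than \<open>l\<close> letters, each residue class contains at most one position, and
  the class of \<open>-1\<close> contains none, so no normalization takes place.\<close>

lemma word_short:
  assumes "w \<in> lists (carrier A)" "length w < l"
  shows "word w = (\<lambda>r. if nat (r mod int l) < length w then w ! nat (r mod int l) else \<one>, int (length w))"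
  using assms
proof (induction w)
  case Nil
  then show ?case by (simp add: twist_group_one)
next
  case (Cons h w)
  let ?d = "\<lambda>r. if nat (r mod int l) < length w then w ! nat (r mod int l) else \<one>"
  have h: "h \<in> carrier A" and w: "w \<in> lists (carrier A)" "Suc (length w) < l"
    and IH: "word w = (?d, int (length w))"
    using Cons by auto
  have "?d (- 1 - 1) = \<one>"
    using w l_ge_2 pred_mod[of "- 1"] by (auto simp: neg_one_mod)
  moreover have "?d (r - 1) \<in> carrier A" for r
    using w by (auto simp: in_lists_conv_set)
  ultimately have "word (h # w) = (\<lambda>r. (if r mod int l = 0 then h else \<one>) \<otimes> ?d (r - 1), 1 + int (length w))"
    by (simp only: word_Cons IH letter_def twist_group_mult inv_one r_one)
  moreover have "(if r mod int l = 0 then h else \<one>) \<otimes> ?d (r - 1)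
      = (if nat (r mod int l) < length (h # w) then (h # w) ! nat (r mod int l) else \<one>)" for r
  proof (cases "r mod int l = 0")
    case True
    then show ?thesis using h w by (auto simp: pred_mod)
  next
    case False
    moreover have "0 \<le> r mod int l" using l_ge_2 by simp
    ultimately have "nat (r mod int l) = Suc (nat ((r - 1) mod int l))"
      by (simp add: pred_mod)
    moreover have "w ! i \<in> carrier A" if "i < length w" for i
      using that w by (auto simp: in_lists_conv_set)
    ultimately show ?thesis using False by simp
  qed
  ultimately show ?case by simp
qed

text \<open>For a word of length \<open>l\<close> every residue class contains exactly one position. Only quotients of two
  letters survive the normalization, and these are insensitive to a common factor.\<close>

lemma word_window:
  assumes "w \<in> lists (carrier A)" "length w = l"
  shows "word w = (\<lambda>r. w ! nat (r mod int l) \<otimes> inv (w ! (l - 1)), int l)"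
proof -
  obtain h v where hv: "w = h # v" and len: "length v = l - 1"
    using assms l_ge_2 by (cases w) auto
  let ?d = "\<lambda>r. if nat (r mod int l) < length v then v ! nat (r mod int l) else \<one>"
  have h: "h \<in> carrier A" and v: "v \<in> lists (carrier A)" and nth: "\<And>i. i < length v \<Longrightarrow> v ! i \<in> carrier A"
    using assms hv by (auto simp: in_lists_conv_set)
  have last: "w ! (l - 1) = v ! (l - 2)" "v ! (l - 2) \<in> carrier A"
  proof -
    have "l - 1 = Suc (l - 2)" using l_ge_2 by simp
    then show "w ! (l - 1) = v ! (l - 2)" "v ! (l - 2) \<in> carrier A"
      using hv nth len by simp_all
  qed
  have "?d (- 1 - 1) = v ! (l - 2)"
    using len l_ge_2 pred_mod[of "- 1"] by (auto simp: neg_one_mod nat_diff_distrib numeral_2_eq_2)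
  moreover have "word v = (?d, int (length v))"
    using word_short[OF v] len l_ge_2 by simp
  ultimately have "word w = (\<lambda>r. (if r mod int l = 0 then h else \<one>) \<otimes> (?d (r - 1) \<otimes> inv (v ! (l - 2))), 1 + int (length v))"
    unfolding hv by (simp only: word_Cons letter_def twist_group_mult)
  moreover have "(if r mod int l = 0 then h else \<one>) \<otimes> (?d (r - 1) \<otimes> inv (v ! (l - 2)))
      = w ! nat (r mod int l) \<otimes> inv (w ! (l - 1))" for r
  proof (cases "r mod int l = 0")
    case True
    have "nat (int l - 1) = length v" using len l_ge_2 by arith
    then have "?d (r - 1) = \<one>" using True by (simp add: pred_mod)
    then show ?thesis using True h last hv by simp
  next
    case False
    moreover have "0 \<le> r mod int l" "r mod int l < int l" using l_ge_2 by simp_all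
    ultimately have "nat (r mod int l) = Suc (nat ((r - 1) mod int l))" "nat ((r - 1) mod int l) < length v"
      using len by (simp_all add: pred_mod nat_less_iff)
    then show ?thesis using False nth last hv by simp
  qed
  ultimately show ?thesis
    using len l_ge_2 by (simp add: fun_eq_iff)
qed

lemma word_translate:
  assumes "w \<in> lists (carrier A)" "length w = l" "s \<in> carrier A"
  shows "word (map ((\<otimes>) s) w) = word w"
proof -
  have nth: "w ! i \<in> carrier A" if "i < l" for i
    using assms that by (auto simp: in_lists_conv_set)
  have "s \<otimes> a \<otimes> inv (s \<otimes> b) = a \<otimes> inv b" if "a \<in> carrier A" "b \<in> carrier A" for a b
  proof -
    have "s \<otimes> a \<otimes> inv (s \<otimes> b) = (a \<otimes> inv b) \<otimes> (s \<otimes> inv s)"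
      using that assms(3) by (simp only: inv_mult inv_closed m_closed m_ac)
    then show ?thesis using that assms(3) by simp
  qed
  moreover have "nat (r mod int l) < l" for r
    using l_ge_2 by (simp add: nat_less_iff)
  moreover have "map ((\<otimes>) s) w \<in> lists (carrier A)"
    using assms by (auto simp: in_lists_conv_set)
  ultimately show ?thesis
    using assms nth l_ge_2 by (simp add: word_window)
qed

lemma word_short_inj:
  assumes "u \<in> lists (carrier A)" "v \<in> lists (carrier A)" "length u < l" "word u = word v"
  shows "u = v"
proof (rule nth_equalityI)
  show len: "length u = length v"
    using arg_cong[OF assms(4), of snd] by (simp add: snd_word)
  fix i assume "i < length u"
  then show "u ! i = v ! i"
    using fun_cong[OF arg_cong[OF assms(4), of fst], of "int i"] assms(1-3) len
    by (simp add: word_short)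
qed

lemma word_of_tuple:
  assumes "c \<in> tuples"
  shows "word (map (\<lambda>i. c (int i)) [0..<l - 1]) = (c, int (l - 1))"
proof -
  have "(if nat (r mod int l) < l - 1 then c (int (nat (r mod int l))) else \<one>) = c r" for r
  proof -
    have r: "0 \<le> r mod int l" "r mod int l < int l" using l_ge_2 by simp_all
    show ?thesis
    proof (cases "nat (r mod int l) < l - 1")
      case True
      then show ?thesis
        using r tuplesD(2)[OF assms] by simp
    next
      case False
      then have "r mod int l = (- 1) mod int l"
        using r neg_one_mod l_ge_2 by linarith
      then show ?thesis
        using False tuples_periodic[OF assms] tuples_normalized[OF assms] by metis
    qed
  qed
  moreover have "map (\<lambda>i. c (int i)) [0..<l - 1] \<in> lists (carrier A)"
    using assms by auto
  ultimately show ?thesis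
    using l_ge_2 by (simp add: word_short cong: if_cong)
qed

lemma letter_one: "letter \<one> = (\<lambda>r. \<one>, 1)"
  by (simp add: letter_def)

lemma letter_one_pow: "letter \<one> [^]\<^bsub>twist_group\<^esub> (k::nat) = (\<lambda>r. \<one>, int k)"
  by (induction k) (simp_all add: letter_one twist_group_one twist_group_mult)

lemma word_replicate_one: "word (replicate k \<one>) = letter \<one> [^]\<^bsub>twist_group\<^esub> k"
  unfolding letter_one_pow
  by (induction k) (simp_all add: letter_one twist_group_one twist_group_mult)

text \<open>Multiplication by this power shifts tuples by a full period.\<close>

lemma letter_one_pow_l_central:
  assumes "x \<in> carrier twist_group"
  shows "letter \<one> [^]\<^bsub>twist_group\<^esub> l \<otimes>\<^bsub>twist_group\<^esub> x = x \<otimes>\<^bsub>twist_group\<^esub> letter \<one> [^]\<^bsub>twist_group\<^esub> l"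
proof -
  obtain c k where x: "x = (c, k)" and c: "c \<in> tuples"
    using assms by (cases x) (simp add: mem_twist_group)
  have "c (r - int l) = c r" for r
    by (rule tuples_periodic[OF c]) simp
  then show ?thesis
    using c by (simp add: x letter_one_pow twist_group_mult tuples_normalized)
qed

text \<open>In degree \<open>l - 1\<close> the letters are the entries of the tuple. Higher degrees are reduced to this one
  by splitting off a power of the letter \<open>\<one>\<close>.\<close>

lemma ex_word_of_degree:
  assumes x: "x \<in> carrier twist_group" and "snd x = int m" "l - 1 \<le> m"
  obtains w where "w \<in> lists (carrier A)" "length w = m" "word w = x"
proof -
  let ?t = "letter \<one> [^]\<^bsub>twist_group\<^esub> (m - (l - 1))"
  define y where "y = inv\<^bsub>twist_group\<^esub> ?t \<otimes>\<^bsub>twist_group\<^esub> x"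
  have y: "y \<in> carrier twist_group" and ty: "?t \<otimes>\<^bsub>twist_group\<^esub> y = x"
    using x by (simp_all add: y_def flip: \<Gamma>.m_assoc)
  have "snd y = int (l - 1)"
    using arg_cong[OF ty, of snd] assms by (simp add: snd_mult letter_one_pow)
  then obtain c where c: "y = (c, int (l - 1))" "c \<in> tuples"
    using y by (cases y) (auto simp: mem_twist_group)
  let ?w = "replicate (m - (l - 1)) \<one> @ map (\<lambda>i. c (int i)) [0..<l - 1]"
  show ?thesis
  proof
    show "?w \<in> lists (carrier A)" "length ?w = m"
      using c assms by auto
    have "word ?w = ?t \<otimes>\<^bsub>twist_group\<^esub> y"
      using c by (subst word_append) (auto simp: word_of_tuple[simplified] word_replicate_one)
    also note ty
    finally show "word ?w = x" .
  qed
qed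

lemma degree_hom: "snd \<in> hom twist_group integer_group"
  by (simp add: hom_def snd_mult)

lemma finite_kernel_degree:
  assumes "finite (carrier A)"
  shows "finite (kernel twist_group integer_group snd)"
proof (rule finite_subset)
  show "kernel twist_group integer_group snd \<subseteq>
      (\<lambda>w. inv\<^bsub>twist_group\<^esub> (letter \<one> [^]\<^bsub>twist_group\<^esub> (l - 1)) \<otimes>\<^bsub>twist_group\<^esub> word w) ` {w. set w \<subseteq> carrier A \<and> length w = l - 1}"
  proof
    fix x assume "x \<in> kernel twist_group integer_group snd"
    then have x: "x \<in> carrier twist_group" "snd x = 0"
      by (simp_all add: kernel_def)
    let ?t = "letter \<one> [^]\<^bsub>twist_group\<^esub> (l - 1)"
    have "?t \<otimes>\<^bsub>twist_group\<^esub> x \<in> carrier twist_group"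
      using x by simp
    moreover have "snd (?t \<otimes>\<^bsub>twist_group\<^esub> x) = int (l - 1)"
      using x by (simp add: snd_mult letter_one_pow)
    ultimately obtain w where "w \<in> lists (carrier A)" "length w = l - 1" "word w = ?t \<otimes>\<^bsub>twist_group\<^esub> x"
      using ex_word_of_degree[OF _ _ order_refl] by metis
    moreover from this have "x = inv\<^bsub>twist_group\<^esub> ?t \<otimes>\<^bsub>twist_group\<^esub> word w"
      using x by (simp flip: \<Gamma>.m_assoc)
    ultimately show "x \<in> (\<lambda>w. inv\<^bsub>twist_group\<^esub> ?t \<otimes>\<^bsub>twist_group\<^esub> word w) ` {w. set w \<subseteq> carrier A \<and> length w = l - 1}"
      by (auto simp: in_lists_conv_set)
  qed
  show "finite ((\<lambda>w. inv\<^bsub>twist_group\<^esub> (letter \<one> [^]\<^bsub>twist_group\<^esub> (l - 1)) \<otimes>\<^bsub>twist_group\<^esub> word w) ` {w. set w \<subseteq> carrier A \<and> length w = l - 1})"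
    using assms by (simp add: finite_lists_length_eq)
qed

text \<open>In degree zero nothing is shifted, so multiplication is entrywise, and the entry at \<open>-1\<close> is the
  only constrained one.\<close>

lemma kernel_degree_iso:
  "(\<lambda>x. \<lambda>i\<in>{..<l - 1}. fst x (int i)) \<in>
    iso (twist_group\<lparr>carrier := kernel twist_group integer_group snd\<rparr>) (product_group {..<l - 1} (\<lambda>_. A))"
  (is "?f \<in> iso ?K ?P")
proof -
  have K: "x \<in> carrier ?K \<longleftrightarrow> fst x \<in> tuples \<and> snd x = 0" for x
    by (cases x) (simp add: kernel_def mem_twist_group)
  have hom: "?f \<in> hom ?K ?P"
  proof (rule homI)
    fix x y assume "x \<in> carrier ?K" "y \<in> carrier ?K"
    then show "?f (x \<otimes>\<^bsub>?K\<^esub> y) = ?f x \<otimes>\<^bsub>?P\<^esub> ?f y"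
      unfolding K by (cases x; cases y) (auto simp: twist_group_mult tuples_normalized fun_eq_iff)
  next
    fix x assume "x \<in> carrier ?K"
    then show "?f x \<in> carrier ?P"
      unfolding K by simp
  qed
  have "bij_betw ?f (carrier ?K) (carrier ?P)"
    unfolding bij_betw_def
  proof
    show "inj_on ?f (carrier ?K)"
    proof (rule inj_onI)
      fix x y assume xy: "x \<in> carrier ?K" "y \<in> carrier ?K" and eq: "?f x = ?f y"
      have "fst x (int i) = fst y (int i)" if "i < l - 1" for i
        using fun_cong[OF eq, of i] that by simp
      then have "map (\<lambda>i. fst x (int i)) [0..<l - 1] = map (\<lambda>i. fst y (int i)) [0..<l - 1]"
        by simp
      then have "(fst x, int (l - 1)) = (fst y, int (l - 1))"
        using xy word_of_tuple unfolding K by metis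
      then show "x = y"
        using xy unfolding K by (simp add: prod_eq_iff)
    qed
    show "?f ` carrier ?K = carrier ?P"
    proof (intro equalityI subsetI)
      fix p assume p: "p \<in> carrier ?P"
      let ?w = "map p [0..<l - 1]"
      have w: "?w \<in> lists (carrier A)" using p by (auto simp: PiE_iff)
      have "word ?w \<in> carrier twist_group" using w by (rule word_closed)
      then have "(fst (word ?w), 0) \<in> carrier ?K"
        unfolding K by (cases "word ?w") (simp add: mem_twist_group)
      moreover have "p = ?f (fst (word ?w), 0)"
      proof
        fix i show "p i = ?f (fst (word ?w), 0) i"
          using p w l_ge_2 by (auto simp: word_short PiE_iff extensional_def)
      qed
      ultimately show "p \<in> ?f ` carrier ?K" by blast
    next
      fix p assume "p \<in> ?f ` carrier ?K"
      then show "p \<in> carrier ?P" using hom_carrier[OF hom] by blast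
    qed
  qed
  with hom show ?thesis by (simp add: iso_def)
qed

end

section \<open>The monoid of a transitive abelian permutation group\<close>

locale transitive_abelian =
  fixes n l :: nat and H :: "(nat \<Rightarrow> nat) set"
  assumes n_pos: "n \<ge> 1" and l_ge_2: "l \<ge> 2"
    and subgroup: "subgroup H (sym_group n)"
    and abelian: "comm_group (sym_group n \<lparr>carrier := H\<rparr>)"
    and transitive: "transitive_on H {1..n}"

sublocale transitive_abelian \<subseteq> cyclic_twist "sym_group n \<lparr>carrier := H\<rparr>" l
  using abelian l_ge_2 by (simp add: cyclic_twist_def cyclic_twist_axioms_def)

context transitive_abelian
begin

\<comment> \<open>The point \<open>1\<close> would otherwise be rewritten to \<open>Suc 0\<close>.\<close>
declare One_nat_def [simp del]

abbreviation S where "S \<equiv> S_monoid n l H"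
abbreviation cong where "cong \<equiv> pres_cong {1..n} (S_rels n l H)"

lemma H_mult [simp]: "mult (sym_group n \<lparr>carrier := H\<rparr>) = (\<circ>)"
  by (simp add: sym_group_mult)

lemma H_one [simp]: "one (sym_group n \<lparr>carrier := H\<rparr>) = id"
  by (simp add: sym_group_one)

lemma H_comp [intro]: "\<sigma> \<in> H \<Longrightarrow> \<tau> \<in> H \<Longrightarrow> \<sigma> \<circ> \<tau> \<in> H"
  using m_closed by simp

lemma H_id: "id \<in> H"
  using one_closed by simp

lemma H_commute: "\<sigma> \<in> H \<Longrightarrow> \<tau> \<in> H \<Longrightarrow> \<sigma> \<circ> \<tau> = \<tau> \<circ> \<sigma>"
  using m_comm by simp

lemma H_permutes: "\<sigma> \<in> H \<Longrightarrow> \<sigma> permutes {1..n}"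
  using subgroup.subset[OF subgroup] by (auto simp: sym_group_carrier)

lemma H_in [simp]: "\<sigma> \<in> H \<Longrightarrow> \<sigma> i \<in> {1..n} \<longleftrightarrow> i \<in> {1..n}"
  by (rule permutes_in_image[OF H_permutes])

lemma H_inverse:
  assumes "\<sigma> \<in> H"
  obtains \<tau> where "\<tau> \<in> H" "\<tau> \<circ> \<sigma> = id"
  using l_inv_ex[of \<sigma>] assms by auto

lemma finite_H: "finite H"
proof (rule finite_subset)
  show "H \<subseteq> {\<sigma>. \<sigma> permutes {1..n}}" using H_permutes by blast
qed (simp add: finite_permutations)

text \<open>Regularity of transitive abelian groups: \<open>\<sigma> (\<rho> 1) = \<rho> (\<sigma> 1)\<close>, and \<open>\<rho> 1\<close> ranges over all
  points.\<close>

lemma H_determined_by_one: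
  assumes "\<sigma> \<in> H" "\<tau> \<in> H" "\<sigma> 1 = \<tau> 1"
  shows "\<sigma> = \<tau>"
proof
  fix i
  show "\<sigma> i = \<tau> i"
  proof (cases "i \<in> {1..n}")
    case True
    then obtain \<rho> where \<rho>: "\<rho> \<in> H" "\<rho> 1 = i"
      using transitive n_pos by (force simp: transitive_on_def)
    have "\<sigma> i = \<rho> (\<sigma> 1)" "\<tau> i = \<rho> (\<tau> 1)"
      using fun_cong[OF H_commute[OF assms(1) \<rho>(1)], of 1] fun_cong[OF H_commute[OF assms(2) \<rho>(1)], of 1] \<rho>(2) by auto
    then show ?thesis by (simp add: assms(3))
  next
    case False
    then show ?thesis
      using permutes_not_in[OF H_permutes[OF assms(1)]] permutes_not_in[OF H_permutes[OF assms(2)]] by metis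
  qed
qed

definition perm_of :: "nat \<Rightarrow> nat \<Rightarrow> nat" where
  "perm_of i = (THE \<sigma>. \<sigma> \<in> H \<and> \<sigma> 1 = i)"

lemma perm_of_eqI: "\<sigma> \<in> H \<Longrightarrow> perm_of (\<sigma> 1) = \<sigma>"
  unfolding perm_of_def using H_determined_by_one by (intro the_equality) auto

lemma perm_of:
  assumes "i \<in> {1..n}"
  shows "perm_of i \<in> H" "perm_of i 1 = i"
proof -
  obtain \<sigma> where "\<sigma> \<in> H" "\<sigma> 1 = i"
    using transitive n_pos assms by (force simp: transitive_on_def)
  then show "perm_of i \<in> H" "perm_of i 1 = i"
    using perm_of_eqI by auto
qed

lemma perm_of_one: "perm_of 1 = id"
  using perm_of_eqI[OF H_id] by simp

text \<open>Under the renaming of letters the action of \<open>H\<close> becomes left multiplication.\<close>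

lemma perm_of_apply: "\<sigma> \<in> H \<Longrightarrow> i \<in> {1..n} \<Longrightarrow> perm_of (\<sigma> i) = \<sigma> \<circ> perm_of i"
  using perm_of_eqI[of "\<sigma> \<circ> perm_of i"] perm_of[of i] H_comp by simp

text \<open>The invariant of a word in the indices of the generators, after the index \<open>i\<close> is replaced
  by the permutation that maps \<open>1\<close> to \<open>i\<close>.\<close>

definition eval :: "nat list \<Rightarrow> (int \<Rightarrow> nat \<Rightarrow> nat) \<times> int" where
  "eval w = word (map perm_of w)"

lemma map_perm_of: "w \<in> lists {1..n} \<Longrightarrow> map perm_of w \<in> lists H"
  using perm_of by (auto simp: in_lists_conv_set)

lemma eval_closed [simp]: "w \<in> lists {1..n} \<Longrightarrow> eval w \<in> carrier twist_group"
  using word_closed map_perm_of by (simp add: eval_def)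

lemma eval_append:
  "u \<in> lists {1..n} \<Longrightarrow> v \<in> lists {1..n} \<Longrightarrow> eval (u @ v) = eval u \<otimes>\<^bsub>twist_group\<^esub> eval v"
  using word_append map_perm_of by (simp add: eval_def)

lemma ex_eval_of_degree:
  assumes "x \<in> carrier twist_group" "snd x = int m" "l - 1 \<le> m"
  obtains w where "w \<in> lists {1..n}" "length w = m" "eval w = x"
proof -
  obtain v where v: "v \<in> lists H" "length v = m" "word v = x"
    using ex_word_of_degree[OF assms] by auto
  show ?thesis
  proof (rule that)
    have "1 \<in> {1..n}" using n_pos by simp
    then show "map (\<lambda>\<sigma>. \<sigma> 1) v \<in> lists {1..n}"
      using v by (auto simp: in_lists_conv_set simp del: atLeastAtMost_iff)
    have "map perm_of (map (\<lambda>\<sigma>. \<sigma> 1) v) = v"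
      using v by (auto simp: in_lists_conv_set perm_of_eqI intro: map_idI)
    then show "eval (map (\<lambda>\<sigma>. \<sigma> 1) v) = x"
      using v by (simp add: eval_def)
  qed (use v in simp)
qed

lemma map_in_lists: "\<sigma> \<in> H \<Longrightarrow> w \<in> lists {1..n} \<Longrightarrow> map \<sigma> w \<in> lists {1..n}"
  by (auto simp: in_lists_conv_set simp del: atLeastAtMost_iff)

lemma cong_imp_eval_eq:
  assumes "(u, v) \<in> cong"
  shows "u \<in> lists {1..n} \<and> v \<in> lists {1..n} \<and> eval u = eval v"
  using assms
proof induction
  case (rel u v)
  then obtain \<sigma> where \<sigma>: "\<sigma> \<in> H" "v = map \<sigma> u" "length u = l"
    by (auto simp: S_rels_def)
  have translate: "map perm_of v = map ((\<circ>) \<sigma>) (map perm_of u)"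
    using rel \<sigma> by (auto simp: in_lists_conv_set perm_of_apply simp del: atLeastAtMost_iff)
  have "eval v = word (map ((\<circ>) \<sigma>) (map perm_of u))"
    by (simp only: eval_def translate)
  also have "\<dots> = eval u"
    using word_translate[of "map perm_of u" \<sigma>] map_perm_of[of u] rel \<sigma> by (simp add: eval_def)
  finally have "eval v = eval u" .
  then show ?case using rel by simp
next
  case (append u v u' v')
  then show ?case by (simp add: eval_append del: in_lists_conv_set)
qed auto

text \<open>Applying a suitable permutation to the first window of a word turns its first letter into \<open>1\<close>;
  this is repeated on the rest of the word as long as a full window is left. A word
  shorter than \<open>l\<close> is its own normal form: the truncated subtraction makes the prefix empty.\<close>

lemma cong_normal_form:
  assumes "u \<in> lists {1..n}"
  shows "\<exists>v \<in> lists {1..n}. length v < l \<and> length v \<le> length u \<and>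
    (u, replicate (length u - (l - 1)) 1 @ v) \<in> cong"
  using assms
proof (induction "length u" arbitrary: u)
  case 0
  then show ?case using l_ge_2 by (auto intro: pres_cong.refl)
next
  case (Suc m)
  show ?case
  proof (cases "length u < l")
    case True
    then have "length u - (l - 1) = 0" by simp
    then show ?thesis
      using True Suc.prems by (auto intro!: bexI[of _ u] pres_cong.refl)
  next
    case False
    have u: "u \<noteq> []" "hd u \<in> {1..n}"
      using Suc by (cases u; auto)+
    \<comment> \<open>The inverse of the permutation that names the first letter sends this letter to \<open>1\<close>.\<close>
    obtain \<tau> where \<tau>: "\<tau> \<in> H" "\<tau> \<circ> perm_of (hd u) = id"
      using H_inverse perm_of(1)[OF u(2)] by metis
    have \<tau>_hd: "\<tau> (hd u) = 1"
      using fun_cong[OF \<tau>(2), of 1] perm_of(2)[OF u(2)] by simp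
    have lists: "take l u \<in> lists {1..n}" "drop l u \<in> lists {1..n}"
      using Suc.prems by (auto simp: in_lists_conv_set dest: in_set_takeD in_set_dropD)
    have window: "(take l u, map \<tau> (take l u)) \<in> cong"
      using lists \<tau> False map_in_lists by (intro pres_cong.rel) (auto simp: S_rels_def)
    define y where "y = tl (map \<tau> (take l u)) @ drop l u"
    have "map \<tau> (take l u) @ drop l u = 1 # y"
      using u \<tau>_hd l_ge_2 by (cases u; cases l) (auto simp: y_def)
    then have first: "(u, 1 # y) \<in> cong"
      using pres_cong.append[OF window pres_cong.refl[OF lists(2)]] by simp
    have y: "y \<in> lists {1..n}" "length y = m"
      using cong_imp_eval_eq[OF first] Suc.hyps(2) False l_ge_2 by (auto simp: y_def)
    obtain v where v: "v \<in> lists {1..n}" "length v < l" "length v \<le> length y"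
      and yv: "(y, replicate (length y - (l - 1)) 1 @ v) \<in> cong"
      using Suc.hyps(1)[of y] y by blast
    have "([1], [1]) \<in> cong"
      using n_pos by (intro pres_cong.refl) simp
    then have "(1 # y, 1 # replicate (length y - (l - 1)) 1 @ v) \<in> cong"
      using pres_cong.append[OF _ yv, of "[1]" "[1]"] by simp
    moreover have "length u - (l - 1) = Suc (length y - (l - 1))"
      using y Suc.hyps(2) False l_ge_2 by simp
    ultimately have "(u, replicate (length u - (l - 1)) 1 @ v) \<in> cong"
      using pres_cong.trans[OF first] by simp
    then show ?thesis
      using v y Suc.hyps(2) by auto
  qed
qed

text \<open>Words with equal invariants have equal lengths, so their normal forms start with the same power of
  the letter \<open>1\<close>. It cancels in the group, and the remaining short words are determined by their
  invariants.\<close>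

lemma cong_iff_eval_eq:
  "(u, v) \<in> cong \<longleftrightarrow> u \<in> lists {1..n} \<and> v \<in> lists {1..n} \<and> eval u = eval v"
proof
  assume uv: "u \<in> lists {1..n} \<and> v \<in> lists {1..n} \<and> eval u = eval v"
  then have "snd (eval u) = snd (eval v)"
    by simp
  then have len: "length u = length v"
    by (simp add: eval_def snd_word)
  let ?r = "replicate (length u - (l - 1)) 1"
  obtain u' where u': "u' \<in> lists {1..n}" "length u' < l" "(u, ?r @ u') \<in> cong"
    using cong_normal_form uv by blast
  obtain v' where v': "v' \<in> lists {1..n}" "length v' < l" "(v, ?r @ v') \<in> cong"
    using cong_normal_form[of v] uv unfolding len by blast
  have r: "?r \<in> lists {1..n}" using n_pos by auto
  have "eval (?r @ u') = eval (?r @ v')"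
    using cong_imp_eval_eq[OF u'(3)] cong_imp_eval_eq[OF v'(3)] uv by simp
  then have "eval u' = eval v'"
    using r u'(1) v'(1) by (simp add: eval_append del: in_lists_conv_set)
  then have "map perm_of u' = map perm_of v'"
    using word_short_inj map_perm_of u' v' by (simp add: eval_def)
  moreover have "inj_on perm_of {1..n}"
    by (metis inj_onI perm_of(2))
  then have "inj_on perm_of (set u' \<union> set v')"
  proof (rule inj_on_subset)
    show "set u' \<union> set v' \<subseteq> {1..n}"
      using u'(1) v'(1) by (simp add: lists_eq_set)
  qed
  ultimately have "u' = v'"
    by (rule map_inj_on)
  then show "(u, v) \<in> cong"
    using u'(3) v'(3) pres_cong.sym pres_cong.trans by metis
qed (rule cong_imp_eval_eq)

lemma presented_monoid_embedding:
  obtains \<phi> where "monoid S" "\<phi> \<in> hom S twist_group" "\<phi> \<one>\<^bsub>S\<^esub> = \<one>\<^bsub>twist_group\<^esub>"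
    "inj_on \<phi> (carrier S)" "\<phi> ` carrier S = eval ` lists {1..n}"
    "\<And>i. i \<in> {1..n} \<Longrightarrow> S_gen n l H i \<in> carrier S"
    "\<And>i. i \<in> {1..n} \<Longrightarrow> \<phi> (S_gen n l H i) = letter (perm_of i)"
proof -
  obtain \<phi> where \<phi>: "monoid S" "\<phi> \<in> hom S twist_group" "\<phi> \<one>\<^bsub>S\<^esub> = \<one>\<^bsub>twist_group\<^esub>"
    "inj_on \<phi> (carrier S)" "\<phi> ` carrier S = eval ` lists {1..n}"
    "\<And>w. w \<in> lists {1..n} \<Longrightarrow> \<phi> (cong `` {w}) = eval w"
    by (rule monoid_quotient_by_kernel[where p = eval and r = cong and op = "(@)" and e = "[]" and Q = S
          and M = twist_group, OF \<Gamma>.is_monoid cong_iff_eval_eq eval_closed _ eval_append])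
      (auto simp: S_monoid_def presented_monoid_def eval_def)
  show ?thesis
  proof (rule that[OF \<phi>(1-5)])
    fix i assume i: "i \<in> {1..n}"
    then show "S_gen n l H i \<in> carrier S"
      by (auto simp: S_gen_def presented_gen_def S_monoid_def presented_monoid_def intro!: quotientI)
    show "\<phi> (S_gen n l H i) = letter (perm_of i)"
      using \<phi>(6)[of "[i]"] i perm_of(1)[OF i] by (simp add: S_gen_def presented_gen_def eval_def)
  qed
qed

abbreviation Z where "Z \<equiv> submonoid_gen S {S_gen n l H 1 [^]\<^bsub>S\<^esub> l}"
abbreviation G where "G \<equiv> loc_monoid S Z"
abbreviation gen where "gen i \<equiv> loc_map S Z (S_gen n l H i)"

lemma one_in: "1 \<in> {1..n}"
  using n_pos by simp

lemma letter_perm_of_one: "letter (perm_of 1) = letter \<one>\<^bsub>sym_group n\<lparr>carrier := H\<rparr>\<^esub>"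
  by (simp add: perm_of_one)

text \<open>An element of arbitrary degree reaches degree at least \<open>l - 1\<close>, and hence the image of the
  monoid, after multiplication by a power of \<open>x\<^sub>1\<^sup>l\<close>.\<close>

lemma localization_iso:
  obtains \<theta> where "\<theta> \<in> iso G twist_group" "group_of_fractions S G (loc_map S Z)"
    "\<And>i. i \<in> {1..n} \<Longrightarrow> gen i \<in> carrier G"
    "\<And>i. i \<in> {1..n} \<Longrightarrow> \<theta> (gen i) = letter (perm_of i)"
proof -
  obtain \<phi> where S: "monoid S" and \<phi>: "\<phi> \<in> hom S twist_group" "\<phi> \<one>\<^bsub>S\<^esub> = \<one>\<^bsub>twist_group\<^esub>"
      "inj_on \<phi> (carrier S)" and \<phi>_image: "\<phi> ` carrier S = eval ` lists {1..n}"
    and gen_closed: "\<And>i. i \<in> {1..n} \<Longrightarrow> S_gen n l H i \<in> carrier S"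
    and \<phi>_gen: "\<And>i. i \<in> {1..n} \<Longrightarrow> \<phi> (S_gen n l H i) = letter (perm_of i)"
    using presented_monoid_embedding by metis
  interpret S: monoid S by (rule S)
  let ?g = "S_gen n l H 1" and ?t = "letter \<one>\<^bsub>sym_group n\<lparr>carrier := H\<rparr>\<^esub>"
  have g: "?g \<in> carrier S"
    using gen_closed one_in .
  have t: "?t \<in> carrier twist_group"
    using letter_closed one_closed .
  have \<phi>_pow: "\<phi> (s [^]\<^bsub>S\<^esub> k) = \<phi> s [^]\<^bsub>twist_group\<^esub> k" if "s \<in> carrier S" for s and k :: nat
    by (induction k) (simp_all add: \<phi>(2) hom_mult[OF \<phi>(1)] that)
  have \<phi>_g: "\<phi> ((?g [^]\<^bsub>S\<^esub> l) [^]\<^bsub>S\<^esub> k) = (?t [^]\<^bsub>twist_group\<^esub> l) [^]\<^bsub>twist_group\<^esub> k" for k :: nat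
    by (simp only: \<phi>_pow g S.nat_pow_closed \<phi>_gen[OF one_in] letter_perm_of_one)
  have Z: "Z = range (\<lambda>k::nat. (?g [^]\<^bsub>S\<^esub> l) [^]\<^bsub>S\<^esub> k)" "submonoid Z S"
    using S.submonoid_gen_singleton g by simp_all
  obtain \<theta> where \<theta>: "\<theta> \<in> iso G twist_group" "group_of_fractions S G (loc_map S Z)"
    "\<And>s. s \<in> carrier S \<Longrightarrow> loc_map S Z s \<in> carrier G"
    "\<And>s. s \<in> carrier S \<Longrightarrow> \<theta> (loc_map S Z s) = \<phi> s"
  proof (rule central_localization_embedding[OF S \<Gamma>.is_group Z(2) \<phi>])
    fix z \<gamma> assume "z \<in> Z" and \<gamma>: "\<gamma> \<in> carrier twist_group"
    then obtain k :: nat where "\<phi> z = (?t [^]\<^bsub>twist_group\<^esub> l) [^]\<^bsub>twist_group\<^esub> k"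
      unfolding Z(1) using \<phi>_g by blast
    then show "\<phi> z \<otimes>\<^bsub>twist_group\<^esub> \<gamma> = \<gamma> \<otimes>\<^bsub>twist_group\<^esub> \<phi> z"
      using \<Gamma>.group_commutes_pow[OF letter_one_pow_l_central[OF \<gamma>] _ \<gamma>] t by simp
  next
    fix \<gamma> assume \<gamma>: "\<gamma> \<in> carrier twist_group"
    \<comment> \<open>As \<open>l \<ge> 1\<close>, adding \<open>l k\<close> raises the degree by at least the missing amount \<open>k\<close>.\<close>
    define k where "k = nat (int (l - 1) - snd \<gamma>)"
    let ?tk = "(?t [^]\<^bsub>twist_group\<^esub> l) [^]\<^bsub>twist_group\<^esub> k"
    have "snd ?tk = int (l * k)"
      by (subst \<Gamma>.nat_pow_pow[OF t]) (simp only: letter_one_pow snd_conv)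
    then have "snd (\<gamma> \<otimes>\<^bsub>twist_group\<^esub> ?tk) = snd \<gamma> + int (l * k)"
      by (simp only: snd_mult)
    moreover have "1 * k \<le> l * k"
      using l_ge_2 by (intro mult_le_mono1) simp
    then have "int k \<le> int (l * k)"
      by (simp only: of_nat_le_iff mult_1)
    then have "snd \<gamma> + int (l * k) \<ge> int (l - 1)"
      unfolding k_def by linarith
    ultimately have "snd (\<gamma> \<otimes>\<^bsub>twist_group\<^esub> ?tk) = int (nat (snd \<gamma> + int (l * k)))"
      "l - 1 \<le> nat (snd \<gamma> + int (l * k))"
      by linarith+
    then obtain w where "w \<in> lists {1..n}" "eval w = \<gamma> \<otimes>\<^bsub>twist_group\<^esub> ?tk"
      using ex_eval_of_degree \<gamma> t by (metis \<Gamma>.m_closed \<Gamma>.nat_pow_closed)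
    then have "\<gamma> \<otimes>\<^bsub>twist_group\<^esub> ?tk \<in> \<phi> ` carrier S"
      unfolding \<phi>_image by (metis imageI)
    then obtain s where s: "s \<in> carrier S" "\<phi> s = \<gamma> \<otimes>\<^bsub>twist_group\<^esub> ?tk"
      by (rule imageE) simp
    show "\<exists>s\<in>carrier S. \<exists>z\<in>Z. \<gamma> \<otimes>\<^bsub>twist_group\<^esub> \<phi> z = \<phi> s"
    proof (intro bexI)
      show "\<gamma> \<otimes>\<^bsub>twist_group\<^esub> \<phi> ((?g [^]\<^bsub>S\<^esub> l) [^]\<^bsub>S\<^esub> k) = \<phi> s"
        by (simp only: \<phi>_g s)
      show "(?g [^]\<^bsub>S\<^esub> l) [^]\<^bsub>S\<^esub> k \<in> Z"
        unfolding Z(1) by (rule rangeI)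
    qed (rule s)
  qed (rule that)
  show ?thesis
    using that[OF \<theta>(1,2)] \<theta>(3,4) gen_closed \<phi>_gen by simp
qed

end

theorem proposition2p4:
  fixes n l :: nat and H :: "(nat \<Rightarrow> nat) set"
  assumes "n \<ge> 1" and "l \<ge> 2"
    and "subgroup H (sym_group n)"
    and "comm_group (sym_group n \<lparr>carrier := H\<rparr>)"
    and "transitive_on H {1..n}"
  shows "let S = S_monoid n l H;
             Z = submonoid_gen S {S_gen n l H 1 [^]\<^bsub>S\<^esub> l};
             G = loc_monoid S Z;
             \<iota> = loc_map S Z;
             x = (\<lambda>i. \<iota> (S_gen n l H i));
             T = torsion_elements G
         in group_of_fractions S G \<iota> \<and>
            (T = {x 1 [^]\<^bsub>G\<^esub> (- int l + 1) \<otimes>\<^bsub>G\<^esub> foldr (\<otimes>\<^bsub>G\<^esub>) (map x js) \<one>\<^bsub>G\<^esub> | js.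
                    js \<in> lists {1..n} \<and> length js = l - 1} \<and>
             T \<lhd> G \<and>
             comm_group (G \<lparr>carrier := T\<rparr>) \<and>
             G \<lparr>carrier := T\<rparr> \<cong> product_group {..<l - 1} (\<lambda>_. sym_group n \<lparr>carrier := H\<rparr>)) \<and>
            internal_semidirect G T (generate G {x 1}) \<and>
            (central_subgroup (generate G {x 1 [^]\<^bsub>G\<^esub> l}) G \<and>
             finite (rcosets\<^bsub>G\<^esub> (generate G {x 1 [^]\<^bsub>G\<^esub> l})))"
proof -
  interpret A: transitive_abelian n l H
    using assms by (simp add: transitive_abelian_def)
  let ?G = "A.G" and ?x = "A.gen" and ?\<Gamma> = "A.twist_group"
  obtain \<theta> where \<theta>_iso: "\<theta> \<in> iso ?G ?\<Gamma>" and fractions: "group_of_fractions A.S ?G (loc_map A.S A.Z)"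
    and x: "\<And>i. i \<in> {1..n} \<Longrightarrow> ?x i \<in> carrier ?G"
    and \<theta>x: "\<And>i. i \<in> {1..n} \<Longrightarrow> \<theta> (?x i) = A.letter (A.perm_of i)"
    using A.localization_iso by metis
  interpret G: group ?G
    using fractions by (simp add: group_of_fractions_def)
  interpret \<theta>: group_hom ?G ?\<Gamma> \<theta>
    using \<theta>_iso by (simp add: group_hom_def group_hom_axioms_def iso_def G.is_group A.\<Gamma>.is_group)
  have inj: "inj_on \<theta> (carrier ?G)" and surj: "\<theta> ` carrier ?G = carrier ?\<Gamma>"
    using \<theta>_iso by (simp_all add: iso_iff)
  define \<delta> where "\<delta> = snd \<circ> \<theta>"
  have \<delta>: "\<delta> \<in> hom ?G integer_group"
    unfolding \<delta>_def by (rule hom_compose[OF \<theta>.homh A.degree_hom])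
  interpret \<delta>: group_hom ?G integer_group \<delta>
    using \<delta> by (simp add: group_hom_def group_hom_axioms_def G.is_group)
  define T where "T = kernel ?G integer_group \<delta>"
  have T_image: "\<theta> ` T = kernel ?\<Gamma> integer_group snd"
    unfolding T_def kernel_def \<delta>_def surj[symmetric] by auto
  have T_subset: "T \<subseteq> carrier ?G"
    by (auto simp: T_def kernel_def)
  have inj_T: "inj_on \<theta> T"
    using inj T_subset by (rule inj_on_subset)
  have "finite T"
    using A.finite_kernel_degree A.finite_H T_image inj_T by (simp add: finite_image_iff[symmetric])
  note fin = this[unfolded T_def]
  have torsion: "torsion_elements ?G = T"
    unfolding T_def by (rule G.torsion_elements_eq_kernel[OF \<delta> fin])
  have x1: "?x 1 \<in> carrier ?G"
    by (rule x[OF A.one_in])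
  have \<theta>x1: "\<theta> (?x 1) = A.letter \<one>\<^bsub>sym_group n\<lparr>carrier := H\<rparr>\<^esub>"
    using \<theta>x[OF A.one_in] by (simp only: A.letter_perm_of_one)
  have \<delta>x1: "\<delta> (?x 1) = 1"
    by (simp only: \<delta>_def o_apply \<theta>x1 A.letter_one snd_conv)
  have semidirect: "internal_semidirect ?G T (generate ?G {?x 1})"
    unfolding T_def by (rule G.kernel_semidirect_degree_one[OF \<delta> x1 \<delta>x1])
  then have T_normal: "T \<lhd> ?G"
    by (simp add: internal_semidirect_def)
  have central: "?x 1 [^]\<^bsub>?G\<^esub> l \<otimes>\<^bsub>?G\<^esub> g = g \<otimes>\<^bsub>?G\<^esub> ?x 1 [^]\<^bsub>?G\<^esub> l" if g: "g \<in> carrier ?G" for g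
  proof (rule inj_onD[OF inj])
    show "\<theta> (?x 1 [^]\<^bsub>?G\<^esub> l \<otimes>\<^bsub>?G\<^esub> g) = \<theta> (g \<otimes>\<^bsub>?G\<^esub> ?x 1 [^]\<^bsub>?G\<^esub> l)"
      using A.letter_one_pow_l_central[OF \<theta>.hom_closed[OF g]] g x1
      by (simp only: \<theta>.hom_mult \<theta>.hom_nat_pow \<theta>x1 G.nat_pow_closed)
  qed (use g x1 in simp_all)
  have l_pos: "l > 0"
    using assms by simp
  note index = G.finite_index_power_of_degree_one[OF \<delta> fin x1 \<delta>x1 l_pos central]

  have T_group: "group (?G\<lparr>carrier := T\<rparr>)"
    using T_normal by (simp add: G.subgroup_imp_group normal_imp_subgroup)
  have "\<theta> \<in> iso (?G\<lparr>carrier := T\<rparr>) (?\<Gamma>\<lparr>carrier := kernel ?\<Gamma> integer_group snd\<rparr>)"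
    using inj_T T_image T_subset by (auto simp: iso_iff hom_def intro!: \<theta>.hom_mult)
  then have "?G\<lparr>carrier := T\<rparr> \<cong> ?\<Gamma>\<lparr>carrier := kernel ?\<Gamma> integer_group snd\<rparr>"
    by (rule is_isoI)
  then have T_iso: "?G\<lparr>carrier := T\<rparr> \<cong> product_group {..<l - 1} (\<lambda>_. sym_group n \<lparr>carrier := H\<rparr>)"
    using is_isoI[OF A.kernel_degree_iso] by (rule iso_trans)
  have T_comm: "comm_group (?G\<lparr>carrier := T\<rparr>)"
  proof (rule comm_group.iso_imp_comm_group)
    show "comm_group (product_group {..<l - 1} (\<lambda>_. sym_group n \<lparr>carrier := H\<rparr>))"
      by (rule comm_product_group) (rule assms)
    show "product_group {..<l - 1} (\<lambda>_. sym_group n \<lparr>carrier := H\<rparr>) \<cong> ?G\<lparr>carrier := T\<rparr>"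
      by (rule group.iso_sym[OF T_group T_iso])
    show "monoid (?G\<lparr>carrier := T\<rparr>)"
      using T_group by (rule group.is_monoid)
  qed

  let ?prod = "\<lambda>js. foldr (\<otimes>\<^bsub>?G\<^esub>) (map ?x js) \<one>\<^bsub>?G\<^esub>"
  have prod: "?prod js \<in> carrier ?G \<and> \<theta> (?prod js) = A.eval js" if "js \<in> lists {1..n}" for js
    using that by (induction js) (simp_all add: x \<theta>x A.eval_def)
  have "T = {?x 1 [^]\<^bsub>?G\<^esub> (- int l + 1) \<otimes>\<^bsub>?G\<^esub> ?prod js |js. js \<in> lists {1..n} \<and> length js = l - 1}"
  proof (intro equalityI subsetI)
    fix g assume "g \<in> T"
    then have g: "g \<in> carrier ?G" "\<delta> g = 0"
      by (simp_all add: T_def kernel_def)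
    \<comment> \<open>Torsion elements have degree zero, so this moves \<open>g\<close> into degree \<open>l - 1\<close>, where every element is a product of generators.\<close>
    define y where "y = ?x 1 [^]\<^bsub>?G\<^esub> (int l - 1) \<otimes>\<^bsub>?G\<^esub> g"
    have y: "y \<in> carrier ?G"
      using g x1 by (simp add: y_def)
    have "\<delta> y = int l - 1"
      using g x1 by (simp add: y_def \<delta>.hom_int_pow \<delta>x1)
    then have "snd (\<theta> y) = int (l - 1)"
      using l_pos by (simp add: \<delta>_def)
    then obtain js where js: "js \<in> lists {1..n}" "length js = l - 1" "A.eval js = \<theta> y"
      using A.ex_eval_of_degree[OF \<theta>.hom_closed[OF y] _ order_refl] by metis
    then have "?prod js = y"
      using inj_onD[OF inj] prod y by metis
    moreover have "g = ?x 1 [^]\<^bsub>?G\<^esub> (- int l + 1) \<otimes>\<^bsub>?G\<^esub> y"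
    proof -
      have "?x 1 [^]\<^bsub>?G\<^esub> (- int l + 1) \<otimes>\<^bsub>?G\<^esub> y = ?x 1 [^]\<^bsub>?G\<^esub> ((- int l + 1) + (int l - 1)) \<otimes>\<^bsub>?G\<^esub> g"
        unfolding y_def by (simp only: G.int_pow_mult[OF x1, of "- int l + 1" "int l - 1"] G.m_assoc G.int_pow_closed g x1)
      then show ?thesis using g by simp
    qed
    ultimately show "g \<in> {?x 1 [^]\<^bsub>?G\<^esub> (- int l + 1) \<otimes>\<^bsub>?G\<^esub> ?prod js |js. js \<in> lists {1..n} \<and> length js = l - 1}"
      using js by blast
  next
    fix g assume "g \<in> {?x 1 [^]\<^bsub>?G\<^esub> (- int l + 1) \<otimes>\<^bsub>?G\<^esub> ?prod js |js. js \<in> lists {1..n} \<and> length js = l - 1}"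
    then obtain js where g: "g = ?x 1 [^]\<^bsub>?G\<^esub> (- int l + 1) \<otimes>\<^bsub>?G\<^esub> ?prod js"
      and js: "js \<in> lists {1..n}" "length js = l - 1"
      by blast
    have "\<delta> (?prod js) = int l - 1"
      using prod[OF js(1)] js(2) l_pos by (simp add: \<delta>_def A.eval_def A.snd_word)
    then have "\<delta> g = 0"
      using prod[OF js(1)] x1 by (simp add: g \<delta>.hom_int_pow \<delta>x1)
    then show "g \<in> T"
      using prod[OF js(1)] x1 by (simp add: T_def kernel_def g)
  qed
  then show ?thesis
    unfolding Let_def torsion
    by (intro conjI fractions T_normal T_comm T_iso semidirect index)
qed

end
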